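(* For every constant $c_0>0$ there exist constants $C_1,c_2,C_3>0$ such that the following holds in the spherical Gaussian mixture setting described in the context. Suppose $k\le c_0m$, denote $S:=\|\Gamma\|_{2\to2}/\Delta_{\min}$, and pick $\epsilon=C_1Sk\sigma$. Perform the rounding scheme described in the context, with this $\epsilon$, on the columns of $PX_D$. Then with high probability as $n\to\infty$ (probability tending to $1$ with all other parameters fixed), the output $\{v_i\}_{i=1}^k$ satisfies $$\|v_i-\tilde\gamma_{\pi(i)}\|_2\le C_3\,Sk\sigma\qquad\text{for all } i\in\{1,\dots,k\}$$ for some permutation $\pi$ of $\{1,\dots,k\}$, provided $\sigma\le c_2\,\Delta_{\min}/(Sk)$.
   Context: Setting. Let $k\ge2$, $m\ge1$, $\sigma>0$, and let $\gamma_1,\dots,\gamma_k\in\mathbb R^m$ be distinct. For each $a\in\{1,\dots,k\}$, $n$ points $x_{a,1},\dots,x_{a,n}$ are drawn from $\mathcal N(\gamma_a,\sigma^2I_m)$, all points independent; $N=kn$. $\Delta_{\min}=\min_{a\neq b}\|\gamma_a-\gamma_b\|_2$. $\tilde\gamma_a:=\frac1n\sum_{i=1}^n x_{a,i}$, and $\Gamma$ is the $m\times k$ matrix whose $a$th column is $\tilde\gamma_a-\frac1k\sum_{b=1}^k\tilde\gamma_b$. $\|\cdot\|_{2\to2}$ is the spectral norm. $D$ is the $N\times N$ matrix of squared Euclidean distances between the points, and $X_D$ is a minimizer of $$\text{minimize } \operatorname{Tr}(DX)\quad\text{subject to}\quad \operatorname{Tr}(X)=k,\ X1=1,\ X\ge0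 \text{ (entrywise)},\ X\succeq0 .$$ $P$ is the $m\times N$ matrix whose $(a,i)$th column is $x_{a,i}$; $c_{a,i}$ denotes the $(a,i)$th column of $PX_D$. Rounding scheme with parameter $\epsilon$: form the graph $G$ with vertices $\{c_{a,i}\}$ (indexed by pairs $(a,i)$, so counted with multiplicity), distinct vertices $c_{a,i},c_{b,j}$ being adjacent if $\|c_{a,i}-c_{b,j}\|_2\le2\epsilon$. For each $i=1,\dots,k$ in turn, select a vertex $v_i$ of maximum degree in the current graph (breaking ties arbitrarily) and remove from the graph every vertex $w$ with $\|w-v_i\|_2\le4\epsilon$. *)

theory Defs
  imports "HOL-Probability.Probability" "HOL-Combinatorics.Permutations"
    "Jordan_Normal_Form.Matrix"
begin

(* Dimensions vary inside the statement (m and k are quantified after the constants, n tends to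
   infinity), so vectors and matrices are those of Jordan_Normal_Form.Matrix, with explicit
   carriers; all indices start at 0. *)

unbundle no inner_syntax
no_notation Finite_Cartesian_Product.vec_nth (infixl \<open>$\<close> 90)
hide_type (open) Finite_Cartesian_Product.vec
hide_const (open) Finite_Cartesian_Product.vec

definition vnorm :: "real vec \<Rightarrow> real" where
  "vnorm v = sqrt (v \<bullet> v)"

definition spectral_norm :: "real mat \<Rightarrow> real" where
  "spectral_norm A = (SUP u \<in> {u \<in> carrier_vec (dim_col A). vnorm u \<le> 1}. vnorm (A *\<^sub>v u))"

definition mat_trace :: "real mat \<Rightarrow> real" where
  "mat_trace A = (\<Sum>i<dim_row A. A $$ (i, i))"

definition psd :: "real mat \<Rightarrow> bool" where
  "psd A \<longleftrightarrow> square_mat A \<and> transpose_mat A = A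
     \<and> (\<forall>u \<in> carrier_vec (dim_row A). 0 \<le> u \<bullet> (A *\<^sub>v u))"

(* N(mu, sigma^2 I_m): independent coordinates, the j-th one being N(mu_j, sigma^2). *)
definition spherical_gaussian :: "nat \<Rightarrow> real vec \<Rightarrow> real \<Rightarrow> (nat \<Rightarrow> real) measure" where
  "spherical_gaussian m \<mu> \<sigma> =
     (\<Pi>\<^sub>M j\<in>{..<m}. density lborel (normal_density (\<mu> $ j) \<sigma>))"

(* A sample \<omega> assigns to each pair (a, i) the coordinates of the point x_{a,i}. *)
type_synonym sample = "nat \<times> nat \<Rightarrow> nat \<Rightarrow> real"

definition mixture_sample ::
  "nat \<Rightarrow> nat \<Rightarrow> (nat \<Rightarrow> real vec) \<Rightarrow> real \<Rightarrow> nat \<Rightarrow> sample measure" where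
  "mixture_sample m k \<gamma> \<sigma> n =
     (\<Pi>\<^sub>M ai \<in> {..<k} \<times> {..<n}. spherical_gaussian m (\<gamma> (fst ai)) \<sigma>)"

definition \<Delta>_min :: "nat \<Rightarrow> (nat \<Rightarrow> real vec) \<Rightarrow> real" where
  "\<Delta>_min k \<gamma> = Min {vnorm (\<gamma> a - \<gamma> b) | a b. a < k \<and> b < k \<and> a \<noteq> b}"

definition point :: "nat \<Rightarrow> sample \<Rightarrow> nat \<Rightarrow> nat \<Rightarrow> real vec" where
  "point m \<omega> a i = vec m (\<omega> (a, i))"

definition emp_center :: "nat \<Rightarrow> nat \<Rightarrow> sample \<Rightarrow> nat \<Rightarrow> real vec" where
  "emp_center m n \<omega> a = vec m (\<lambda>j. (\<Sum>i<n. point m \<omega> a i $ j) / real n)"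

definition \<Gamma>_mat :: "nat \<Rightarrow> nat \<Rightarrow> nat \<Rightarrow> sample \<Rightarrow> real mat" where
  "\<Gamma>_mat m k n \<omega> = mat m k (\<lambda>(j, a).
     emp_center m n \<omega> a $ j - (\<Sum>b<k. emp_center m n \<omega> b $ j) / real k)"

(* The pair (a, i) with a < k, i < n is encoded as the column index a * n + i < k * n. *)
definition data_mat :: "nat \<Rightarrow> nat \<Rightarrow> nat \<Rightarrow> sample \<Rightarrow> real mat" where
  "data_mat m k n \<omega> = mat m (k * n) (\<lambda>(j, p). point m \<omega> (p div n) (p mod n) $ j)"

definition sq_dist_mat :: "real mat \<Rightarrow> real mat" where
  "sq_dist_mat P = mat (dim_col P) (dim_col P) (\<lambda>(p, q). (vnorm (col P p - col P q))\<^sup>2)"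

definition sdp_feasible :: "nat \<Rightarrow> nat \<Rightarrow> real mat \<Rightarrow> bool" where
  "sdp_feasible k N X \<longleftrightarrow> X \<in> carrier_mat N N
     \<and> mat_trace X = real k
     \<and> X *\<^sub>v vec N (\<lambda>_. 1) = vec N (\<lambda>_. 1)
     \<and> (\<forall>p<N. \<forall>q<N. 0 \<le> X $$ (p, q))
     \<and> psd X"

definition sdp_minimizer :: "nat \<Rightarrow> nat \<Rightarrow> real mat \<Rightarrow> real mat \<Rightarrow> bool" where
  "sdp_minimizer k N D X \<longleftrightarrow> sdp_feasible k N X
     \<and> (\<forall>Y. sdp_feasible k N Y \<longrightarrow> mat_trace (D * X) \<le> mat_trace (D * Y))"

(* Vertices are column indices, so that coinciding columns are counted with multiplicity;
   V is the set of vertices of the current graph. *)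
definition vertex_degree :: "(nat \<Rightarrow> real vec) \<Rightarrow> real \<Rightarrow> nat set \<Rightarrow> nat \<Rightarrow> nat" where
  "vertex_degree c \<epsilon> V v = card {w \<in> V. w \<noteq> v \<and> vnorm (c w - c v) \<le> 2 * \<epsilon>}"

(* rounding_output c \<epsilon> r V vs: vs is a possible list of the vertices selected in r rounds started
   on V, for some way of breaking ties. If the graph is exhausted early the list is shorter
   than r, so every finite V has an output and length vs = r has to be proved. *)
inductive rounding_output ::
  "(nat \<Rightarrow> real vec) \<Rightarrow> real \<Rightarrow> nat \<Rightarrow> nat set \<Rightarrow> nat list \<Rightarrow> bool" for c \<epsilon> where
  finished: "rounding_output c \<epsilon> 0 V []"
| exhausted: "rounding_output c \<epsilon> (Suc r) {} []"
| select: "\<lbrakk>v \<in> V; \<And>w. w \<in> V \<Longrightarrow> vertex_degree c \<epsilon> V w \<le> vertex_degree c \<epsilon> V v;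
      rounding_output c \<epsilon> r {w \<in> V. \<not> vnorm (c w - c v) \<le> 4 * \<epsilon>} vs\<rbrakk>
    \<Longrightarrow> rounding_output c \<epsilon> (Suc r) V (v # vs)"

(* The set of outcomes satisfying A n need not be known to be measurable; it is required to contain
   events of probability tending to 1, which for measurable sets is the same as having
   probability tending to 1. *)
definition with_high_probability :: "(nat \<Rightarrow> 'a measure) \<Rightarrow> (nat \<Rightarrow> 'a \<Rightarrow> bool) \<Rightarrow> bool" where
  "with_high_probability M A \<longleftrightarrow> (\<exists>E. (\<forall>n. E n \<in> sets (M n) \<and> (\<forall>\<omega> \<in> E n. A n \<omega>))
     \<and> (\<lambda>n. measure (M n) (E n)) \<longlonglongrightarrow> 1)"

end

theory Submission
  imports Defs
begin

text \<open>
  Write the data matrix as $P = M + Z$, where every column of $M$ is the empirical center of its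
  cluster. Since $X$ is feasible, $0 \preceq X \preceq I$, and $\mathrm{Tr}(DX)$ differs from
  $-2\,\mathrm{Tr}(PXP^T)$ by a constant; comparing $X$ with the matrix that averages over each
  true cluster yields
  \[ \|M(I - X)\|_F^2 \le 2\,\langle M, ZX\rangle + \mathrm{Tr}(ZXZ^T)
     = - 2\,\langle M(I - X), Z\rangle + \mathrm{Tr}(ZXZ^T). \]
  If $\|Z\|_{2\to2}^2 \le L$, the last term is at most $Lk$ because $\mathrm{Tr}(X) = k$, and the
  inner product is at most $\|M(I - X)\|_F^2/4 + Lk$ because $M(I - X)$ has rank at most $k$.
  Hence $\|PX - M\|_F^2 \le 14Lk$. For fixed $m$ and $k$, the law of large numbers applied to
  the entries of $ZZ^T$ gives $L = 2\sigma^2 N$ with high probability, so the mean squared distance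
  of the columns of $PX$ from their centers is at most a constant times $k\sigma^2$. As $S \ge 1/4$
  (test $\Gamma$ on $(e_a - e_b)/2$), at most $0.28\,n$ columns are farther than
  $\epsilon = 40\,Sk\sigma$ from their center, fewer than the other columns of any single cluster; so a vertex of maximum degree always has
  a good column of an untouched cluster within $2\epsilon$, and its removal step deletes
  all good columns of that cluster and none of the others.
\<close>


section \<open>Positive semidefinite forms and the relaxation\<close>

text \<open>Matrices enter as functions on an arbitrary index set, so that the induction in
  \<open>psd_factor\<close> can adjoin one index at a time.\<close>

definition bilin :: "'a set \<Rightarrow> ('a \<Rightarrow> 'a \<Rightarrow> real) \<Rightarrow> ('a \<Rightarrow> real) \<Rightarrow> ('a \<Rightarrow> real) \<Rightarrow> real" where
  "bilin I X u v = (\<Sum>p\<in>I. \<Sum>q\<in>I. X p q * u p * v q)"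

lemma bilin_alt: "bilin I X u v = (\<Sum>p\<in>I. u p * (\<Sum>q\<in>I. X p q * v q))"
  by (simp add: bilin_def sum_distrib_left mult_ac)

lemma bilin_add_left: "bilin I X (\<lambda>p. u p + v p) w = bilin I X u w + bilin I X v w"
  by (simp add: bilin_def algebra_simps sum.distrib)

lemma bilin_add_right: "bilin I X w (\<lambda>p. u p + v p) = bilin I X w u + bilin I X w v"
  by (simp add: bilin_def algebra_simps sum.distrib)

lemma bilin_diff_left: "bilin I X (\<lambda>p. u p - v p) w = bilin I X u w - bilin I X v w"
  by (simp add: bilin_def algebra_simps sum_subtractf)

lemma bilin_diff_right: "bilin I X w (\<lambda>p. u p - v p) = bilin I X w u - bilin I X w v"
  by (simp add: bilin_def algebra_simps sum_subtractf)

lemma bilin_commute: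
  assumes "\<And>p q. p \<in> I \<Longrightarrow> q \<in> I \<Longrightarrow> X p q = X q p"
  shows "bilin I X u v = bilin I X v u"
proof -
  have "bilin I X u v = (\<Sum>q\<in>I. \<Sum>p\<in>I. X p q * u p * v q)"
    unfolding bilin_def by (rule sum.swap)
  also have "\<dots> = bilin I X v u"
    unfolding bilin_def by (intro sum.cong refl) (simp add: assms mult_ac)
  finally show ?thesis .
qed

text \<open>Cholesky factorization by induction on the index set: the rank-one matrix built from the
  row of the new index is split off, and the Schur complement that remains is positive semidefinite
  on the old indices.\<close>

lemma psd_factor:
  fixes X :: "'a \<Rightarrow> 'a \<Rightarrow> real"
  assumes "finite I"
    and "\<And>p q. p \<in> I \<Longrightarrow> q \<in> I \<Longrightarrow> X p q = X q p"
    and "\<And>u. 0 \<le> bilin I X u u"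
  shows "\<exists>F. \<forall>p\<in>I. \<forall>q\<in>I. X p q = (\<Sum>l\<in>I. F l p * F l q)"
  using assms
proof (induction I arbitrary: X rule: finite_induct)
  case empty
  then show ?case by simp
next
  case (insert i I)
  define d where "d = X i i"
  define f where "f p = X i p / sqrt d" for p \<comment> \<open>a Cholesky step; if $d = 0$ then $f = 0$ by division by zero\<close>
  have sym: "X p q = X q p" if "p \<in> insert i I" "q \<in> insert i I" for p q
    using insert.prems(1) that by blast
  have expand: "bilin (insert i I) X u u = d * (u i)\<^sup>2 + 2 * u i * (\<Sum>q\<in>I. X i q * u q) + bilin I X u u" for u
  proof -
    have "(\<Sum>p\<in>I. X p i * u p * u i) = u i * (\<Sum>q\<in>I. X i q * u q)"
      using sym by (auto simp: sum_distrib_left mult_ac intro!: sum.cong)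
    then show ?thesis
      using insert.hyps unfolding bilin_def
      by (simp add: sum.distrib d_def power2_eq_square sum_distrib_left algebra_simps)
  qed
  have d0: "d \<ge> 0"
  proof -
    have "bilin I X (\<lambda>p. if p = i then 1 else 0) (\<lambda>p. if p = i then 1 else 0) = 0"
      unfolding bilin_def using insert.hyps by (intro sum.neutral ballI) auto
    moreover have "(\<Sum>q\<in>I. X i q * (if q = i then 1 else 0)) = 0"
      using insert.hyps by (intro sum.neutral ballI) auto
    ultimately show ?thesis
      using insert.prems(2)[of "\<lambda>p. if p = i then 1 else 0"] expand[of "\<lambda>p. if p = i then 1 else 0"] by simp
  qed
  have zero: "X i q = 0" if "d = 0" "q \<in> I" for q
  proof (rule ccontr)
    assume nz: "X i q \<noteq> 0"
    \<comment> \<open>With this \<open>t\<close>, and with \<open>d = 0\<close>, the form at the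
      vector \<open>u\<close> below equals \<open>X q q - \<bar>X q q\<bar> - 1\<close>, which is
      negative.\<close>
    define t where "t = - (\<bar>X q q\<bar> + 1) / (2 * X i q)"
    define u where "u = (\<lambda>p. if p = i then t else if p = q then 1 else 0)"
    have "q \<noteq> i" using that insert.hyps by auto
    have "bilin I X u u = (\<Sum>p\<in>I. if p = q then X q q else 0)"
      unfolding bilin_def
    proof (intro sum.cong refl)
      fix p assume "p \<in> I"
      then have pi: "p \<noteq> i" using insert.hyps by auto
      have "(\<Sum>r\<in>I. X p r * u p * u r) = (\<Sum>r\<in>I. if r = q then X p q * u p else 0)"
        using insert.hyps by (intro sum.cong refl) (auto simp: u_def)
      then show "(\<Sum>r\<in>I. X p r * u p * u r) = (if p = q then X q q else 0)"
        using that insert.hyps pi by (simp add: u_def)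
    qed
    then have 1: "bilin I X u u = X q q"
      using that insert.hyps by simp
    have "(\<Sum>r\<in>I. X i r * u r) = (\<Sum>r\<in>I. if r = q then X i q else 0)"
      using insert.hyps by (intro sum.cong refl) (auto simp: u_def)
    then have 2: "(\<Sum>r\<in>I. X i r * u r) = X i q"
      using that insert.hyps by simp
    have "0 \<le> 2 * t * X i q + X q q"
      using insert.prems(2)[of u] unfolding expand 1 2 using that by (simp add: u_def)
    moreover have "2 * t * X i q = - (\<bar>X q q\<bar> + 1)"
      using nz by (simp add: t_def)
    ultimately show False by linarith
  qed
  have ff: "f i * f q = X i q" if "q \<in> insert i I" for q
  proof (cases "d = 0")
    case True
    then show ?thesis using that zero by (auto simp: f_def d_def)
  next
    case False
    then have "sqrt d * sqrt d = d" using d0 by simp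
    then show ?thesis using False d0 by (simp add: f_def d_def[symmetric])
  qed
  define X' where "X' p q = X p q - f p * f q" for p q
  have "0 \<le> bilin I X' u u" for u
  proof (cases "d = 0")
    case True
    define w where "w = u(i := 0)"
    have "bilin I X w w = bilin I X u u"
      unfolding bilin_def w_def using insert.hyps by (intro sum.cong refl) auto
    moreover have "w i = 0" by (simp add: w_def)
    moreover have "X' = X" using True by (simp add: X'_def f_def fun_eq_iff)
    ultimately show ?thesis
      using insert.prems(2)[of w] expand[of w] by simp
  next
    case False
    define s where "s = (\<Sum>q\<in>I. X i q * u q)"
    \<comment> \<open>The entry at \<open>i\<close> that minimizes the form when the entries on
      \<open>I\<close> are fixed; the minimum, \<open>bilin I X u u - s\<^sup>2 / d\<close>, is the
      value of the Schur complement \<open>X'\<close> at \<open>u\<close>.\<close>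
    define w where "w = u(i := - s / d)"
    have "bilin I X w w = bilin I X u u"
      unfolding bilin_def w_def using insert.hyps by (intro sum.cong refl) auto
    moreover have "(\<Sum>q\<in>I. X i q * w q) = s"
      unfolding s_def w_def using insert.hyps by (intro sum.cong refl) auto
    moreover have "d * (w i)\<^sup>2 + 2 * w i * s = - s\<^sup>2 / d"
      using False by (simp add: w_def power2_eq_square)
    ultimately have 1: "0 \<le> bilin I X u u - s\<^sup>2 / d"
      using insert.prems(2)[of w] expand[of w] by simp
    have "(\<Sum>p\<in>I. \<Sum>q\<in>I. f p * f q * u p * u q) = (\<Sum>p\<in>I. f p * u p)\<^sup>2"
      by (simp add: power2_eq_square sum_product mult_ac)
    also have "(\<Sum>p\<in>I. f p * u p) = s / sqrt d"
      by (simp add: f_def s_def sum_divide_distrib)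
    finally have "(\<Sum>p\<in>I. \<Sum>q\<in>I. f p * f q * u p * u q) = s\<^sup>2 / d"
      using d0 by (simp add: power_divide)
    with 1 show ?thesis
      by (simp add: bilin_def X'_def left_diff_distrib sum_subtractf)
  qed
  moreover have "X' p q = X' q p" if "p \<in> I" "q \<in> I" for p q
    using sym[of p q] that by (simp add: X'_def)
  ultimately obtain F where F: "\<forall>p\<in>I. \<forall>q\<in>I. X' p q = (\<Sum>l\<in>I. F l p * F l q)"
    using insert.IH[of X'] by blast
  \<comment> \<open>Row \<open>i\<close> of the new factor is \<open>f\<close>; the old rows get 0
    in column \<open>i\<close>, so that the entries of \<open>X\<close> involving \<open>i\<close>
    come from \<open>f\<close> alone.\<close>
  define H where "H l p = (if l = i then f p else if p = i then 0 else F l p)" for l p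
  have "X p q = (\<Sum>l\<in>insert i I. H l p * H l q)" if pq: "p \<in> insert i I" "q \<in> insert i I" for p q
  proof -
    have "(\<Sum>l\<in>insert i I. H l p * H l q) = f p * f q + (\<Sum>l\<in>I. H l p * H l q)"
      using insert.hyps by (simp add: H_def)
    also have "(\<Sum>l\<in>I. H l p * H l q) = (if p = i \<or> q = i then 0 else (\<Sum>l\<in>I. F l p * F l q))"
      using insert.hyps by (auto simp: H_def intro!: sum.cong sum.neutral)
    also have "f p * f q + \<dots> = X p q"
    proof (cases "p = i \<or> q = i")
      case True
      then show ?thesis
        using ff[OF pq(2)] ff[OF pq(1)] sym[OF pq] by (auto simp: mult.commute)
    next
      case False
      then have "X' p q = (\<Sum>l\<in>I. F l p * F l q)" using F pq by simp
      with False show ?thesis by (simp add: X'_def)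
    qed
    finally show ?thesis by simp
  qed
  then show ?case by blast
qed

section \<open>Noise matrices of bounded operator norm\<close>

text \<open>A matrix and its transpose have the same operator norm: with w = zv, |w|^2 is the inner
  product of z^T w and v, so Cauchy-Schwarz gives |w|^4 <= L |w|^2 |v|^2, and |w|^2 cancels.\<close>

lemma sum_sq_transpose_le:
  fixes z :: "'j \<Rightarrow> 'a \<Rightarrow> real"
  assumes L: "L \<ge> 0" and bd: "\<And>u. (\<Sum>p\<in>I. (\<Sum>j\<in>J. u j * z j p)\<^sup>2) \<le> L * (\<Sum>j\<in>J. (u j)\<^sup>2)"
  shows "(\<Sum>j\<in>J. (\<Sum>p\<in>I. z j p * v p)\<^sup>2) \<le> L * (\<Sum>p\<in>I. (v p)\<^sup>2)"
proof -
  define w where "w j = (\<Sum>p\<in>I. z j p * v p)" for j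
  define W where "W = (\<Sum>j\<in>J. (w j)\<^sup>2)"
  define V where "V = (\<Sum>p\<in>I. (v p)\<^sup>2)"
  have nn: "W \<ge> 0" "V \<ge> 0" by (auto simp: W_def V_def intro: sum_nonneg)
  have "W = (\<Sum>j\<in>J. \<Sum>p\<in>I. w j * z j p * v p)"
    unfolding W_def power2_eq_square by (subst (2) w_def) (simp add: sum_distrib_left mult_ac)
  also have "\<dots> = (\<Sum>p\<in>I. (\<Sum>j\<in>J. w j * z j p) * v p)"
    by (subst sum.swap) (simp add: sum_distrib_right)
  finally have "W\<^sup>2 \<le> (\<Sum>p\<in>I. (\<Sum>j\<in>J. w j * z j p)\<^sup>2) * V"
    using Cauchy_Schwarz_ineq_sum[of "\<lambda>p. \<Sum>j\<in>J. w j * z j p" v I] by (simp add: V_def)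
  also have "\<dots> \<le> (L * W) * V"
    using bd[of w] nn by (intro mult_right_mono) (auto simp: W_def)
  finally have "W * W \<le> W * (L * V)" by (simp add: power2_eq_square mult_ac)
  then have "W \<le> L * V"
    using nn L by (cases "W = 0") (auto simp: mult_le_cancel_left)
  then show ?thesis by (simp add: W_def w_def V_def)
qed

text \<open>Writing \<open>X\<close> as a sum of rank-one matrices with vectors \<open>F l\<close>
  turns the left side into the sum of the |z (F l)|^2, while the |F l|^2 add up to the
  trace.\<close>

lemma sum_bilin_le_trace:
  fixes z :: "'j \<Rightarrow> 'a \<Rightarrow> real"
  assumes fin: "finite I"
    and sym: "\<And>p q. p \<in> I \<Longrightarrow> q \<in> I \<Longrightarrow> X p q = X q p"
    and psd: "\<And>u. 0 \<le> bilin I X u u"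
    and L: "L \<ge> 0" and bd: "\<And>u. (\<Sum>p\<in>I. (\<Sum>j\<in>J. u j * z j p)\<^sup>2) \<le> L * (\<Sum>j\<in>J. (u j)\<^sup>2)"
  shows "(\<Sum>j\<in>J. bilin I X (z j) (z j)) \<le> L * (\<Sum>p\<in>I. X p p)"
proof -
  obtain F where F: "\<forall>p\<in>I. \<forall>q\<in>I. X p q = (\<Sum>l\<in>I. F l p * F l q)"
    using psd_factor[OF fin sym psd] by blast
  have eq: "bilin I X u u = (\<Sum>l\<in>I. (\<Sum>p\<in>I. u p * F l p)\<^sup>2)" for u
  proof -
    have "bilin I X u u = (\<Sum>p\<in>I. \<Sum>q\<in>I. \<Sum>l\<in>I. (u p * F l p) * (u q * F l q))"
      unfolding bilin_def using F
      by (intro sum.cong refl) (simp add: sum_distrib_right sum_distrib_left mult_ac)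
    also have "\<dots> = (\<Sum>p\<in>I. \<Sum>l\<in>I. \<Sum>q\<in>I. (u p * F l p) * (u q * F l q))"
      by (intro sum.cong refl sum.swap)
    also have "\<dots> = (\<Sum>l\<in>I. \<Sum>p\<in>I. \<Sum>q\<in>I. (u p * F l p) * (u q * F l q))"
      by (rule sum.swap)
    finally show ?thesis by (simp add: power2_eq_square sum_product)
  qed
  have "(\<Sum>j\<in>J. bilin I X (z j) (z j)) = (\<Sum>l\<in>I. \<Sum>j\<in>J. (\<Sum>p\<in>I. z j p * F l p)\<^sup>2)"
    unfolding eq by (rule sum.swap)
  also have "\<dots> \<le> (\<Sum>l\<in>I. L * (\<Sum>p\<in>I. (F l p)\<^sup>2))"
    by (intro sum_mono sum_sq_transpose_le L bd)
  also have "\<dots> = L * (\<Sum>p\<in>I. \<Sum>l\<in>I. (F l p)\<^sup>2)"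
    by (subst sum.swap) (simp add: sum_distrib_left)
  also have "(\<Sum>p\<in>I. \<Sum>l\<in>I. (F l p)\<^sup>2) = (\<Sum>p\<in>I. X p p)"
    using F by (simp add: power2_eq_square)
  finally show ?thesis .
qed

text \<open>The columns of \<open>T\<close> lie in the span of the \<open>card K\<close> vectors
  \<open>g b\<close>. Along each direction of an orthonormal system for that span, t y <= t^2/4 +
  y^2 bounds the pairing, and the y^2 sum to at most \<open>L\<close>. The induction over
  \<open>K\<close> is a Gram-Schmidt process that pays one \<open>L\<close> per vector.\<close>

lemma low_rank_pairing_le:
  fixes z :: "'j \<Rightarrow> 'a \<Rightarrow> real" and g :: "'b \<Rightarrow> 'j \<Rightarrow> real"
  assumes fin: "finite K" "finite J" and L: "L \<ge> 0"
    and bd: "\<And>u. (\<Sum>p\<in>I. (\<Sum>j\<in>J. u j * z j p)\<^sup>2) \<le> L * (\<Sum>j\<in>J. (u j)\<^sup>2)"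
    and T: "\<And>j p. j \<in> J \<Longrightarrow> p \<in> I \<Longrightarrow> T j p = (\<Sum>b\<in>K. h b p * g b j)"
  shows "(\<Sum>j\<in>J. \<Sum>p\<in>I. T j p * z j p) \<le> (\<Sum>j\<in>J. \<Sum>p\<in>I. (T j p)\<^sup>2) / 4 + real (card K) * L"
  using fin(1) T
proof (induction K arbitrary: T g rule: finite_induct)
  case empty
  then show ?case by (simp add: sum_nonneg)
next
  case (insert a K)
  show ?case
  proof (cases "\<forall>j\<in>J. g a j = 0")
    case True
    then have "T j p = (\<Sum>b\<in>K. h b p * g b j)" if "j \<in> J" "p \<in> I" for j p
      using insert.hyps insert.prems[OF that] that by simp
    then have "(\<Sum>j\<in>J. \<Sum>p\<in>I. T j p * z j p) \<le> (\<Sum>j\<in>J. \<Sum>p\<in>I. (T j p)\<^sup>2) / 4 + real (card K) * L"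
      by (rule insert.IH)
    also have "\<dots> \<le> (\<Sum>j\<in>J. \<Sum>p\<in>I. (T j p)\<^sup>2) / 4 + real (card (insert a K)) * L"
      using L insert.hyps by (intro add_left_mono mult_right_mono) auto
    finally show ?thesis .
  next
    case False
    define s where "s = (\<Sum>j\<in>J. (g a j)\<^sup>2)"
    have s: "s > 0"
      using False fin(2) unfolding s_def by (meson sum_pos2 zero_less_power2 zero_le_power2)
    \<comment> \<open>Projecting all columns of \<open>T\<close> off the direction \<open>q\<close> of \<open>g a\<close> leaves columns in the
      span of the other \<open>g b\<close> projected likewise, and both sides split accordingly.\<close>
    define q where "q j = g a j / sqrt s" for j
    have qq: "(\<Sum>j\<in>J. (q j)\<^sup>2) = 1"
      using s by (simp add: q_def power_divide sum_divide_distrib[symmetric] s_def[symmetric])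
    define dot where "dot u = (\<Sum>j\<in>J. u j * q j)" for u
    have ga: "g a j - dot (g a) * q j = 0" for j
    proof -
      have "dot (g a) = s / sqrt s"
        by (simp add: dot_def q_def s_def power2_eq_square sum_divide_distrib)
      then have "dot (g a) = sqrt s" using s by (simp add: real_div_sqrt)
      then show ?thesis using s by (simp add: q_def)
    qed
    define t where "t p = dot (\<lambda>j. T j p)" for p
    define T' where "T' j p = T j p - t p * q j" for j p
    have T'_eq: "T' j p = (\<Sum>b\<in>K. h b p * (g b j - dot (g b) * q j))" if jp: "j \<in> J" "p \<in> I" for j p
    proof -
      have "t p = (\<Sum>j\<in>J. \<Sum>b\<in>insert a K. h b p * g b j * q j)"
        unfolding t_def dot_def using insert.prems jp by (intro sum.cong refl) (simp add: sum_distrib_right)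
      also have "\<dots> = (\<Sum>b\<in>insert a K. h b p * dot (g b))"
        by (subst sum.swap) (simp add: dot_def sum_distrib_left mult_ac)
      finally have "T' j p = (\<Sum>b\<in>insert a K. h b p * (g b j - dot (g b) * q j))"
        using insert.prems[OF jp] unfolding T'_def
        by (simp only: sum_distrib_left right_diff_distrib sum_subtractf mult_ac)
      then show ?thesis using insert.hyps ga by simp
    qed
    have IH: "(\<Sum>j\<in>J. \<Sum>p\<in>I. T' j p * z j p) \<le> (\<Sum>j\<in>J. \<Sum>p\<in>I. (T' j p)\<^sup>2) / 4 + real (card K) * L"
      using insert.IH[OF T'_eq] by simp
    define y where "y p = (\<Sum>j\<in>J. q j * z j p)" for p
    have 1: "(\<Sum>j\<in>J. T j p * z j p) = (\<Sum>j\<in>J. T' j p * z j p) + t p * y p" for p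
      by (simp add: T'_def y_def algebra_simps sum_subtractf sum.distrib sum_distrib_left)
    have 2: "(\<Sum>j\<in>J. (T j p)\<^sup>2) = (\<Sum>j\<in>J. (T' j p)\<^sup>2) + (t p)\<^sup>2" for p
    proof -
      have "(\<Sum>j\<in>J. (T' j p)\<^sup>2) = (\<Sum>j\<in>J. (T j p)\<^sup>2 - 2 * t p * (T j p * q j) + (t p)\<^sup>2 * (q j)\<^sup>2)"
        by (intro sum.cong refl) (simp add: T'_def power2_eq_square algebra_simps)
      also have "\<dots> = (\<Sum>j\<in>J. (T j p)\<^sup>2) - 2 * t p * (\<Sum>j\<in>J. T j p * q j) + (t p)\<^sup>2 * (\<Sum>j\<in>J. (q j)\<^sup>2)"
        by (simp only: sum.distrib sum_subtractf sum_distrib_left)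
      finally show ?thesis unfolding qq by (simp add: t_def dot_def power2_eq_square)
    qed
    have 3: "t p * y p \<le> (t p)\<^sup>2 / 4 + (y p)\<^sup>2" for p
      using zero_le_power2[of "t p / 2 - y p"] by (simp add: power2_eq_square algebra_simps)
    have "(\<Sum>p\<in>I. t p * y p) \<le> (\<Sum>p\<in>I. (t p)\<^sup>2) / 4 + (\<Sum>p\<in>I. (y p)\<^sup>2)"
      using sum_mono[of I, OF 3] by (simp add: sum.distrib sum_divide_distrib)
    also have "(\<Sum>p\<in>I. (y p)\<^sup>2) \<le> L"
      using bd[of q] by (simp add: y_def qq)
    finally have 4: "(\<Sum>p\<in>I. t p * y p) \<le> (\<Sum>p\<in>I. (t p)\<^sup>2) / 4 + L" by simp
    have "(\<Sum>j\<in>J. \<Sum>p\<in>I. T j p * z j p) = (\<Sum>j\<in>J. \<Sum>p\<in>I. T' j p * z j p) + (\<Sum>p\<in>I. t p * y p)"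
      by (subst (1 2) sum.swap) (simp add: 1 sum.distrib)
    moreover have "(\<Sum>j\<in>J. \<Sum>p\<in>I. (T j p)\<^sup>2) = (\<Sum>j\<in>J. \<Sum>p\<in>I. (T' j p)\<^sup>2) + (\<Sum>p\<in>I. (t p)\<^sup>2)"
      by (subst (1 2) sum.swap) (simp add: 2 sum.distrib)
    ultimately show ?thesis
      using IH 4 insert.hyps by (simp add: algebra_simps add_divide_distrib)
  qed
qed

section \<open>Contractions and doubly stochastic matrices\<close>

text \<open>In operator terms, 0 <= X <= I implies X^2 <= X. The form at v - Xv is nonnegative and
  expands to <v, Xv> - 2 |Xv|^2 + <Xv, XXv>, whose last term is at most |Xv|^2.\<close>

lemma contraction_norm_le_bilin:
  assumes sym: "\<And>p q. p \<in> I \<Longrightarrow> q \<in> I \<Longrightarrow> X p q = X q p"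
    and psd: "\<And>u. 0 \<le> bilin I X u u"
    and le1: "\<And>u. bilin I X u u \<le> (\<Sum>p\<in>I. (u p)\<^sup>2)"
  shows "(\<Sum>p\<in>I. (\<Sum>q\<in>I. X p q * v q)\<^sup>2) \<le> bilin I X v v"
proof -
  define w where "w p = (\<Sum>q\<in>I. X p q * v q)" for p
  have "bilin I X w v = (\<Sum>p\<in>I. (w p)\<^sup>2)"
    by (simp add: bilin_alt w_def power2_eq_square)
  moreover have "bilin I X v w = bilin I X w v" by (rule bilin_commute[OF sym])
  moreover have "bilin I X (\<lambda>p. v p - w p) (\<lambda>p. v p - w p)
      = bilin I X v v - bilin I X v w - bilin I X w v + bilin I X w w"
    by (simp add: bilin_diff_left bilin_diff_right)
  ultimately show ?thesis
    using psd[of "\<lambda>p. v p - w p"] le1[of w] by (simp add: w_def)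
qed

text \<open>This is X <= I for feasible X: the inequality 2 u_p u_q <= u_p^2 + u_q^2 is summed with
  weights \<open>X p q\<close>, whose rows and, by symmetry, columns sum to 1.\<close>

lemma bilin_stochastic_le:
  assumes sym: "\<And>p q. p \<in> I \<Longrightarrow> q \<in> I \<Longrightarrow> X p q = X q p"
    and nonneg: "\<And>p q. p \<in> I \<Longrightarrow> q \<in> I \<Longrightarrow> 0 \<le> X p q"
    and row: "\<And>p. p \<in> I \<Longrightarrow> (\<Sum>q\<in>I. X p q) = 1"
  shows "bilin I X u u \<le> (\<Sum>p\<in>I. (u p)\<^sup>2)"
proof -
  have "X p q * u p * u q \<le> X p q * (u p)\<^sup>2 / 2 + X p q * (u q)\<^sup>2 / 2" if "p \<in> I" "q \<in> I" for p q
  proof -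
    have "u p * u q \<le> (u p)\<^sup>2 / 2 + (u q)\<^sup>2 / 2"
      using zero_le_power2[of "u p - u q"] by (simp add: power2_eq_square algebra_simps)
    from mult_left_mono[OF this nonneg[OF that]] show ?thesis by (simp add: algebra_simps)
  qed
  then have "bilin I X u u \<le> (\<Sum>p\<in>I. \<Sum>q\<in>I. X p q * (u p)\<^sup>2 / 2 + X p q * (u q)\<^sup>2 / 2)"
    unfolding bilin_def by (intro sum_mono)
  also have "\<dots> = (\<Sum>p\<in>I. \<Sum>q\<in>I. X p q * (u p)\<^sup>2 / 2) + (\<Sum>q\<in>I. \<Sum>p\<in>I. X p q * (u q)\<^sup>2 / 2)"
    by (subst (3) sum.swap) (simp add: sum.distrib)
  also have "(\<Sum>q\<in>I. \<Sum>p\<in>I. X p q * (u q)\<^sup>2 / 2) = (\<Sum>p\<in>I. \<Sum>q\<in>I. X p q * (u p)\<^sup>2 / 2)"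
    using sym by (auto intro!: sum.cong)
  also have "(\<Sum>p\<in>I. \<Sum>q\<in>I. X p q * (u p)\<^sup>2 / 2) = (\<Sum>p\<in>I. (\<Sum>q\<in>I. X p q) * (u p)\<^sup>2 / 2)"
    by (simp add: sum_distrib_right sum_divide_distrib)
  also have "\<dots> = (\<Sum>p\<in>I. (u p)\<^sup>2) / 2"
    using row by (simp add: sum_divide_distrib)
  finally show ?thesis by simp
qed

text \<open>The deterministic core. \<open>L\<close> bounds the squared operator norm of the noise;
  \<open>centered\<close> makes the noise orthogonal to the centers, as is the case for cluster
  means; \<open>opt\<close> records that \<open>X\<close> does at least as well as averaging over
  the true clusters.\<close>

lemma denoising_bound:
  fixes x :: "'j \<Rightarrow> 'a \<Rightarrow> real" and g :: "'b \<Rightarrow> 'j \<Rightarrow> real" and cl :: "'a \<Rightarrow> 'b"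
  defines "M \<equiv> \<lambda>j p. g (cl p) j"
  assumes fin: "finite I" "finite J" "finite K" and cl: "cl ` I \<subseteq> K"
    and sym: "\<And>p q. p \<in> I \<Longrightarrow> q \<in> I \<Longrightarrow> X p q = X q p"
    and psd: "\<And>u. 0 \<le> bilin I X u u"
    and nonneg: "\<And>p q. p \<in> I \<Longrightarrow> q \<in> I \<Longrightarrow> 0 \<le> X p q"
    and row: "\<And>p. p \<in> I \<Longrightarrow> (\<Sum>q\<in>I. X p q) = 1"
    and trace: "(\<Sum>p\<in>I. X p p) \<le> real (card K)"
    and centered: "\<And>j. j \<in> J \<Longrightarrow> (\<Sum>p\<in>I. M j p * (x j p - M j p)) = 0"
    and opt: "(\<Sum>j\<in>J. \<Sum>p\<in>I. (M j p)\<^sup>2) \<le> (\<Sum>j\<in>J. bilin I X (x j) (x j))"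
    and L: "L \<ge> 0"
    and bd: "\<And>u. (\<Sum>p\<in>I. (\<Sum>j\<in>J. u j * (x j p - M j p))\<^sup>2) \<le> L * (\<Sum>j\<in>J. (u j)\<^sup>2)"
  shows "(\<Sum>p\<in>I. \<Sum>j\<in>J. ((\<Sum>q\<in>I. X p q * x j q) - M j p)\<^sup>2) \<le> 14 * L * real (card K)"
proof -
  define z where "z j p = x j p - M j p" for j p
  \<comment> \<open>\<open>Y\<close> is I - X, and \<open>T\<close> is M(I - X), the part of the
    centers that \<open>X\<close> fails to reproduce.\<close>
  define Y where "Y p q = of_bool (p = q) - X p q" for p q
  define T where "T j p = (\<Sum>q\<in>I. Y p q * M j q)" for j p
  define A where "A = (\<Sum>j\<in>J. \<Sum>p\<in>I. (T j p)\<^sup>2)"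
  define R where "R = real (card K) * L"
  have delta: "(\<Sum>q\<in>I. of_bool (p = q) * v q) = v p" if "p \<in> I" for p and v :: "'a \<Rightarrow> real"
    using fin(1) that by (simp add: of_bool_def if_distrib[of "\<lambda>t. t * _"] cong: if_cong)
  have Yapp: "(\<Sum>q\<in>I. Y p q * v q) = v p - (\<Sum>q\<in>I. X p q * v q)" if "p \<in> I" for p v
    by (simp add: Y_def left_diff_distrib sum_subtractf delta[OF that])
  have Ybil: "bilin I Y u v = (\<Sum>p\<in>I. u p * v p) - bilin I X u v" for u v
    by (simp add: bilin_alt Yapp right_diff_distrib sum_subtractf cong: sum.cong)
  have le1: "bilin I X u u \<le> (\<Sum>p\<in>I. (u p)\<^sup>2)" for u
    by (rule bilin_stochastic_le[OF sym nonneg row])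
  \<comment> \<open>\<open>Y\<close> also lies between 0 and I, because \<open>X\<close>
    does.\<close>
  have Ysq: "(\<Sum>p\<in>I. (\<Sum>q\<in>I. Y p q * v q)\<^sup>2) \<le> bilin I Y v v" for v
  proof (rule contraction_norm_le_bilin)
    show "Y p q = Y q p" if "p \<in> I" "q \<in> I" for p q
      using sym[OF that] by (auto simp: Y_def)
    show "0 \<le> bilin I Y u u" "bilin I Y u u \<le> (\<Sum>p\<in>I. (u p)\<^sup>2)" for u
      using le1[of u] psd[of u] by (auto simp: Ybil power2_eq_square)
  qed
  have zz: "(\<Sum>j\<in>J. bilin I X (z j) (z j)) \<le> R"
  proof -
    have "(\<Sum>j\<in>J. bilin I X (z j) (z j)) \<le> L * (\<Sum>p\<in>I. X p p)"
      using bd by (intro sum_bilin_le_trace fin sym psd L) (simp_all add: z_def)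
    also have "\<dots> \<le> R" using mult_left_mono[OF trace L] by (simp add: R_def mult.commute)
    finally show ?thesis .
  qed
  \<comment> \<open>Orthogonality of centers and noise allows \<open>X\<close> to be traded for the
    negative of \<open>Y\<close>. The cross term then pairs the noise with \<open>T\<close> rather
    than with M, and can be absorbed into \<open>A\<close>.\<close>
  have cross: "bilin I X (M j) (z j) = - (\<Sum>p\<in>I. T j p * z j p)" if "j \<in> J" for j
  proof -
    have "bilin I X (M j) (z j) = bilin I X (z j) (M j)" by (rule bilin_commute[OF sym])
    also have "\<dots> = (\<Sum>p\<in>I. z j p * M j p) - bilin I Y (z j) (M j)" by (simp add: Ybil)
    also have "(\<Sum>p\<in>I. z j p * M j p) = 0" using centered[OF that] by (simp add: z_def mult.commute)
    finally show ?thesis by (simp add: bilin_alt T_def mult.commute)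
  qed
  have "A \<le> (\<Sum>j\<in>J. bilin I Y (M j) (M j))"
    unfolding A_def T_def by (intro sum_mono Ysq)
  also have "\<dots> = (\<Sum>j\<in>J. \<Sum>p\<in>I. (M j p)\<^sup>2) - (\<Sum>j\<in>J. bilin I X (M j) (M j))"
    by (simp add: Ybil sum_subtractf power2_eq_square)
  also have "\<dots> \<le> (\<Sum>j\<in>J. bilin I X (x j) (x j) - bilin I X (M j) (M j))"
    using opt by (simp add: sum_subtractf)
  also have "\<dots> = (\<Sum>j\<in>J. 2 * bilin I X (M j) (z j) + bilin I X (z j) (z j))"
  proof (intro sum.cong refl)
    fix j
    have "x j = (\<lambda>p. M j p + z j p)" by (simp add: z_def)
    then show "bilin I X (x j) (x j) - bilin I X (M j) (M j) = 2 * bilin I X (M j) (z j) + bilin I X (z j) (z j)"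
      by (simp add: bilin_add_left bilin_add_right bilin_commute[OF sym, where u = "z j" and v = "M j"])
  qed
  also have "\<dots> = 2 * (\<Sum>j\<in>J. \<Sum>p\<in>I. - T j p * z j p) + (\<Sum>j\<in>J. bilin I X (z j) (z j))"
    by (simp add: sum.distrib sum_distrib_left cross sum_negf sum_subtractf)
  also have "(\<Sum>j\<in>J. \<Sum>p\<in>I. - T j p * z j p) \<le> (\<Sum>j\<in>J. \<Sum>p\<in>I. (- T j p)\<^sup>2) / 4 + R"
    unfolding R_def
  proof (rule low_rank_pairing_le[OF fin(3,2) L])
    show "(\<Sum>p\<in>I. (\<Sum>j\<in>J. u j * z j p)\<^sup>2) \<le> L * (\<Sum>j\<in>J. (u j)\<^sup>2)" for u
      using bd[of u] by (simp add: z_def)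
    \<comment> \<open>Grouping the sum over \<open>q\<close> by clusters exhibits each column of
      \<open>T\<close> as a combination of the \<open>card K\<close> centers, which is the rank
      bound.\<close>
    show "- T j p = (\<Sum>b\<in>K. (- (\<Sum>q\<in>{q\<in>I. cl q = b}. Y p q)) * g b j)" for j p
    proof -
      have "T j p = (\<Sum>b\<in>K. \<Sum>q\<in>{q\<in>I. cl q = b}. Y p q * g (cl q) j)"
        unfolding T_def M_def by (rule sum.group[OF fin(1,3) cl, symmetric])
      also have "\<dots> = (\<Sum>b\<in>K. (\<Sum>q\<in>{q\<in>I. cl q = b}. Y p q) * g b j)"
        by (simp add: sum_distrib_right)
      finally show ?thesis by (simp add: sum_negf)
    qed
  qed
  \<comment> \<open>The weight 1/4 of the pairing bound, doubled, leaves A/2, which the left side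
    absorbs.\<close>
  also have "2 * ((\<Sum>j\<in>J. \<Sum>p\<in>I. (- T j p)\<^sup>2) / 4 + R) + (\<Sum>j\<in>J. bilin I X (z j) (z j)) \<le> A / 2 + 3 * R"
    using zz by (simp add: A_def)
  finally have A: "A \<le> 6 * R" by simp
  \<comment> \<open>The error is the filtered noise minus \<open>T\<close>. Doubling both squares
    costs 12 R for \<open>T\<close> and 2 R for the noise, hence the constant 14.\<close>
  have "(\<Sum>p\<in>I. \<Sum>j\<in>J. ((\<Sum>q\<in>I. X p q * x j q) - M j p)\<^sup>2)
      \<le> (\<Sum>p\<in>I. \<Sum>j\<in>J. 2 * (T j p)\<^sup>2 + 2 * (\<Sum>q\<in>I. X p q * z j q)\<^sup>2)"
  proof (intro sum_mono)
    fix p j assume "p \<in> I" "j \<in> J"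
    define s where "s = (\<Sum>q\<in>I. X p q * z j q)"
    have "(\<Sum>q\<in>I. X p q * x j q) - M j p = s - T j p"
      unfolding s_def T_def Yapp[OF \<open>p \<in> I\<close>] by (simp add: z_def right_diff_distrib sum_subtractf)
    moreover have "(s - T j p)\<^sup>2 \<le> 2 * (T j p)\<^sup>2 + 2 * s\<^sup>2"
      using zero_le_power2[of "s + T j p"] by (simp add: power2_eq_square algebra_simps)
    ultimately show "((\<Sum>q\<in>I. X p q * x j q) - M j p)\<^sup>2 \<le> 2 * (T j p)\<^sup>2 + 2 * (\<Sum>q\<in>I. X p q * z j q)\<^sup>2"
      by (simp add: s_def)
  qed
  also have "\<dots> = 2 * A + 2 * (\<Sum>j\<in>J. \<Sum>p\<in>I. (\<Sum>q\<in>I. X p q * z j q)\<^sup>2)"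
    unfolding A_def by (subst sum.swap) (simp add: sum.distrib sum_distrib_left)
  also have "(\<Sum>j\<in>J. \<Sum>p\<in>I. (\<Sum>q\<in>I. X p q * z j q)\<^sup>2) \<le> (\<Sum>j\<in>J. bilin I X (z j) (z j))"
    by (intro sum_mono contraction_norm_le_bilin sym psd le1)
  also have "2 * A + 2 * (\<Sum>j\<in>J. bilin I X (z j) (z j)) \<le> 14 * R"
    using A zz by linarith
  finally show ?thesis by (simp add: R_def mult_ac)
qed

section \<open>Rounding\<close>

lemma vnorm_eq_L2_set: "vnorm v = L2_set (\<lambda>i. v $ i) {..<dim_vec v}"
  by (simp add: vnorm_def L2_set_def scalar_prod_def power2_eq_square atLeast0LessThan)

lemma vnorm_triangle_diff:
  assumes "u \<in> carrier_vec m" "v \<in> carrier_vec m" "w \<in> carrier_vec m"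
  shows "vnorm (u - w) \<le> vnorm (u - v) + vnorm (v - w)"
proof -
  have "vnorm (u - w) = L2_set (\<lambda>i. (u $ i - v $ i) + (v $ i - w $ i)) {..<m}"
    unfolding vnorm_eq_L2_set using assms by (intro L2_set_cong) auto
  also have "\<dots> \<le> L2_set (\<lambda>i. u $ i - v $ i) {..<m} + L2_set (\<lambda>i. v $ i - w $ i) {..<m}"
    by (rule L2_set_triangle_ineq)
  also have "\<dots> = vnorm (u - v) + vnorm (v - w)"
    unfolding vnorm_eq_L2_set using assms by (intro arg_cong2[of _ _ _ _ "(+)"] L2_set_cong) auto
  finally show ?thesis .
qed

lemma vnorm_diff_commute:
  assumes "u \<in> carrier_vec m" "v \<in> carrier_vec m"
  shows "vnorm (u - v) = vnorm (v - u)"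
proof -
  have "(u - v) \<bullet> (u - v) = (v - u) \<bullet> (v - u)"
    using assms unfolding scalar_prod_def by (intro sum.cong) (auto simp: algebra_simps)
  then show ?thesis by (simp add: vnorm_def)
qed

text \<open>Induction over the rounds, with \<open>A\<close> the set of clusters not yet found: the
  current graph contains all their good vertices, and all its other vertices are bad. A good vertex
  is adjacent to all other good vertices of its cluster, which outnumber the bad ones together with
  it, so a vertex of maximum degree has a good vertex within 2 \<epsilon> and hence a center within
  3 \<epsilon>. Good vertices of that cluster are within 4 \<epsilon> of the selected vertex, while
  those of other clusters are farther than (8 - 1 - 3) \<epsilon>.\<close>

lemma rounding_output_near_centers:
  assumes "rounding_output c \<epsilon> r V vs"
    and "finite Bad" "\<epsilon> \<ge> 0"
    and c: "\<And>p. c p \<in> carrier_vec m" and g: "\<And>a. g a \<in> carrier_vec m"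
    and good: "\<And>a p. a \<in> A \<Longrightarrow> p \<in> G a \<Longrightarrow> vnorm (c p - g a) \<le> \<epsilon>"
    and many: "\<And>a. a \<in> A \<Longrightarrow> card Bad < card (G a)"
    and fin: "\<And>a. a \<in> A \<Longrightarrow> finite (G a)"
    and sep: "\<And>a b. a \<in> A \<Longrightarrow> b \<in> A \<Longrightarrow> a \<noteq> b \<Longrightarrow> vnorm (g a - g b) > 8 * \<epsilon>"
    and "finite A" "card A = r" "V \<subseteq> Bad \<union> (\<Union>a\<in>A. G a)" "(\<Union>a\<in>A. G a) \<subseteq> V"
  shows "length vs = r \<and> (\<exists>f. bij_betw f {..<r} A \<and> (\<forall>i<r. vnorm (c (vs ! i) - g (f i)) \<le> 3 * \<epsilon>))"
  using assms(1) good many fin sep assms(10-13)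
proof (induction arbitrary: A rule: rounding_output.induct)
  case (finished V)
  then show ?case by (simp add: bij_betw_def)
next
  case (exhausted r)
  \<comment> \<open>\<open>many\<close> makes every \<open>G a\<close> nonempty, so the graph cannot
    run out while clusters remain.\<close>
  then have "A \<noteq> {}" by auto
  then obtain a where "a \<in> A" by blast
  then show ?case using exhausted.prems(2)[of a] exhausted.prems(8) by auto
next
  case (select v V r vs)
  note good = select.prems(1) and many = select.prems(2) and finG = select.prems(3)
    and sep = select.prems(4) and A = select.prems(5,6) and V = select.prems(7,8)
  have finV: "finite V"
    using V(1) \<open>finite Bad\<close> A(1) finG by (meson finite_UN finite_UnI finite_subset)
  \<comment> \<open>Closed neighborhoods: comparing degrees amounts to comparing their
    cardinalities, with no vertex to exclude.\<close>
  define nb where "nb u = {w \<in> V. vnorm (c w - c u) \<le> 2 * \<epsilon>}" for u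
  have self: "vnorm (c u - c u) = 0" for u
    using c[of u] by (simp add: vnorm_def)
  have card_nb: "card (nb u) = Suc (vertex_degree c \<epsilon> V u)" if "u \<in> V" for u
  proof -
    have "nb u = insert u {w \<in> V. w \<noteq> u \<and> vnorm (c w - c u) \<le> 2 * \<epsilon>}"
      using that self \<open>\<epsilon> \<ge> 0\<close> by (auto simp: nb_def)
    then show ?thesis using finV by (simp add: vertex_degree_def)
  qed
  have tri: "vnorm (c p - c q) \<le> vnorm (c p - g a) + vnorm (c q - g a)" for p q a
    using vnorm_triangle_diff[OF c[of p] g[of a] c[of q]] vnorm_diff_commute[OF c[of q] g[of a]] by simp
  have tri': "vnorm (c p - g a) \<le> vnorm (c p - c q) + vnorm (c q - g a)" for p q a
    using vnorm_triangle_diff[OF c[of p] c[of q] g[of a]] .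
  have tri'': "vnorm (g a - g b) \<le> vnorm (c p - g a) + vnorm (c p - g b)" for p a b
    using vnorm_triangle_diff[OF g[of a] c[of p] g[of b]] vnorm_diff_commute[OF c[of p] g[of a]] by simp
  from A have "A \<noteq> {}" by auto
  then obtain a0 where a0: "a0 \<in> A" by blast
  then obtain p0 where p0: "p0 \<in> G a0" using many[of a0] by fastforce
  have "G a0 \<subseteq> nb p0"
  proof
    fix q assume "q \<in> G a0"
    then show "q \<in> nb p0"
      using good[OF a0 p0] good[OF a0, of q] tri[of q p0 a0] V(2) a0 by (auto simp: nb_def)
  qed
  then have "card (G a0) \<le> card (nb p0)"
    using finV by (intro card_mono) (auto simp: nb_def)
  also have "\<dots> \<le> card (nb v)"
    using select.hyps(1,2) p0 a0 V(2) by (auto simp: card_nb)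
  finally have "card Bad < card (nb v)" using many[OF a0] by simp
  then have "\<not> nb v \<subseteq> Bad" using card_mono[OF \<open>finite Bad\<close>] by (metis not_le)
  then obtain p where p: "p \<in> nb v" "p \<notin> Bad" by blast
  then obtain a where a: "a \<in> A" "p \<in> G a" using V(1) by (auto simp: nb_def)
  have va: "vnorm (c v - g a) \<le> 3 * \<epsilon>"
    using tri'[of v a p] good[OF a] p(1) vnorm_diff_commute[OF c[of v] c[of p]] by (simp add: nb_def)
  define V' where "V' = {w \<in> V. \<not> vnorm (c w - c v) \<le> 4 * \<epsilon>}"
  have Ga: "G a \<inter> V' = {}"
  proof -
    have "vnorm (c q - c v) \<le> 4 * \<epsilon>" if "q \<in> G a" for q
      using tri[of q v a] va good[OF a(1) that] by simp
    then show ?thesis by (auto simp: V'_def)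
  qed
  have "q \<in> V'" if b: "b \<in> A - {a}" "q \<in> G b" for b q
  proof -
    have "vnorm (g b - g a) > 8 * \<epsilon>" using sep b a by auto
    moreover have "vnorm (c q - g b) \<le> \<epsilon>" using good b by blast
    ultimately have "vnorm (c q - g a) > 7 * \<epsilon>" using tri''[of b a q] by simp
    then have "vnorm (c q - c v) > 4 * \<epsilon>" using tri'[of q a v] va by simp
    then show ?thesis using b V(2) by (auto simp: V'_def)
  qed
  then have V'1: "(\<Union>b\<in>A - {a}. G b) \<subseteq> V'" by blast
  have V'2: "V' \<subseteq> Bad \<union> (\<Union>b\<in>A - {a}. G b)"
    using V(1) Ga by (auto simp: V'_def)
  have "length vs = r \<and> (\<exists>f. bij_betw f {..<r} (A - {a}) \<and> (\<forall>i<r. vnorm (c (vs ! i) - g (f i)) \<le> 3 * \<epsilon>))"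
    by (rule select.IH[folded V'_def]) (use good many finG sep A a V'1 V'2 in auto)
  then obtain f where f: "length vs = r" "bij_betw f {..<r} (A - {a})"
    "\<forall>i<r. vnorm (c (vs ! i) - g (f i)) \<le> 3 * \<epsilon>" by blast
  \<comment> \<open>The cluster found in this round is put in front. The resulting map is onto
    \<open>A\<close>, and injective because \<open>card A\<close> is the number of rounds.\<close>
  define f' where "f' = (\<lambda>i. case i of 0 \<Rightarrow> a | Suc j \<Rightarrow> f j)"
  have "f' ` {..<Suc r} = insert a (f ` {..<r})"
    unfolding lessThan_Suc_eq_insert_0 image_insert image_image by (simp add: f'_def)
  then have img: "f' ` {..<Suc r} = A"
    using f(2) a(1) by (auto simp: bij_betw_def)
  then have "bij_betw f' {..<Suc r} A"
    unfolding bij_betw_def using A by (auto intro: eq_card_imp_inj_on)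
  moreover have "vnorm (c ((v # vs) ! i) - g (f' i)) \<le> 3 * \<epsilon>" if "i < Suc r" for i
    using that va f(3) by (cases i) (auto simp: f'_def)
  ultimately show ?case using f(1) by auto
qed

section \<open>Moments and concentration\<close>

text \<open>Independence of two distinct coordinates, read off from the product formula over all of
  \<open>I\<close> with the constant factor 1 at every other coordinate.\<close>

lemma integral_PiM_pair_prod:
  fixes M :: "'i \<Rightarrow> 'a measure" and f h :: "'a \<Rightarrow> real"
  assumes M: "\<And>i. prob_space (M i)" and fin: "finite I" and ij: "i \<in> I" "j \<in> I" "i \<noteq> j"
    and int_f: "integrable (M i) f" and int_h: "integrable (M j) h"
  shows "integrable (PiM I M) (\<lambda>\<omega>. f (\<omega> i) * h (\<omega> j))"
    and "(\<integral>\<omega>. f (\<omega> i) * h (\<omega> j) \<partial>PiM I M) = integral\<^sup>L (M i) f * integral\<^sup>L (M j) h"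
proof -
  interpret M: prob_space "M x" for x by (rule M)
  interpret product_sigma_finite M by standard
  define e where "e l = (if l = i then f else if l = j then h else (\<lambda>_. 1))" for l
  have e: "integrable (M l) (e l)" for l
    using int_f int_h by (simp add: e_def)
  have split: "(\<Prod>l\<in>I. e' l) = e' i * e' j" if "\<And>l. l \<noteq> i \<Longrightarrow> l \<noteq> j \<Longrightarrow> e' l = 1" for e' :: "'i \<Rightarrow> real"
  proof -
    have "prod e' I = e' i * prod e' (I - {i})" using fin ij by (simp add: prod.remove)
    also have "prod e' (I - {i}) = e' j * prod e' (I - {i} - {j})" using fin ij by (intro prod.remove) auto
    also have "prod e' (I - {i} - {j}) = 1" using that by (intro prod.neutral) auto
    finally show ?thesis by simp
  qed
  have 1: "(\<Prod>l\<in>I. e l (\<omega> l)) = f (\<omega> i) * h (\<omega> j)" for \<omega>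
    using split[of "\<lambda>l. e l (\<omega> l)"] ij by (auto simp: e_def)
  have 2: "(\<Prod>l\<in>I. integral\<^sup>L (M l) (e l)) = integral\<^sup>L (M i) f * integral\<^sup>L (M j) h"
    using split[of "\<lambda>l. integral\<^sup>L (M l) (e l)"] ij by (auto simp: e_def M.prob_space)
  show "integrable (PiM I M) (\<lambda>\<omega>. f (\<omega> i) * h (\<omega> j))"
    using product_integrable_prod[of I e, OF fin e] by (simp add: 1)
  show "(\<integral>\<omega>. f (\<omega> i) * h (\<omega> j) \<partial>PiM I M) = integral\<^sup>L (M i) f * integral\<^sup>L (M j) h"
    using product_integral_prod[of I e, OF fin e] by (simp add: 1 2)
qed

lemma integral_PiM_component:
  fixes M :: "'i \<Rightarrow> 'a measure" and f :: "'a \<Rightarrow> real"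
  assumes M: "\<And>i. prob_space (M i)" and i: "i \<in> I" and f: "integrable (M i) f"
  shows "integrable (PiM I M) (\<lambda>\<omega>. f (\<omega> i))"
    and "(\<integral>\<omega>. f (\<omega> i) \<partial>PiM I M) = integral\<^sup>L (M i) f"
proof -
  have d: "distr (PiM I M) (M i) (\<lambda>\<omega>. \<omega> i) = M i"
    by (rule distr_PiM_component[OF M i])
  have m: "(\<lambda>\<omega>. \<omega> i) \<in> measurable (PiM I M) (M i)" using i by simp
  show "integrable (PiM I M) (\<lambda>\<omega>. f (\<omega> i))"
    using f by (intro integrable_distr[OF m]) (simp add: d)
  show "(\<integral>\<omega>. f (\<omega> i) \<partial>PiM I M) = integral\<^sup>L (M i) f"
    using integral_distr[OF m, of f] f by (simp add: d)
qed

text \<open>Chebyshev's inequality: by independence and centering, only the diagonal terms of the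
  squared sum have nonzero expectation.\<close>

lemma prob_PiM_sum_deviation_le:
  fixes M :: "'i \<Rightarrow> 'a measure" and f :: "'a \<Rightarrow> real"
  assumes M: "\<And>i. prob_space (M i)" and fin: "finite I" and J: "J \<subseteq> I"
    and f: "\<And>i. i \<in> J \<Longrightarrow> integrable (M i) f" and f2: "\<And>i. i \<in> J \<Longrightarrow> integrable (M i) (\<lambda>x. (f x)\<^sup>2)"
    and mean: "\<And>i. i \<in> J \<Longrightarrow> integral\<^sup>L (M i) f = 0"
    and var: "\<And>i. i \<in> J \<Longrightarrow> (\<integral>x. (f x)\<^sup>2 \<partial>M i) \<le> B" and a: "a > 0"
  shows "measure (PiM I M) {\<omega> \<in> space (PiM I M). a \<le> \<bar>\<Sum>i\<in>J. f (\<omega> i)\<bar>} \<le> real (card J) * B / a\<^sup>2"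
proof -
  interpret P: prob_space "PiM I M" using M by (rule prob_space_PiM)
  have finJ: "finite J" using J fin by (rule finite_subset)
  define S where "S \<omega> = (\<Sum>i\<in>J. f (\<omega> i))" for \<omega>
  have comp: "integrable (PiM I M) (\<lambda>\<omega>. f (\<omega> i))" "(\<integral>\<omega>. f (\<omega> i) \<partial>PiM I M) = 0" if "i \<in> J" for i
    using integral_PiM_component[where M = M, OF M _ f[OF that], of I] mean[OF that] that J by auto
  have pair: "integrable (PiM I M) (\<lambda>\<omega>. f (\<omega> i) * f (\<omega> j)) \<and>
      (\<integral>\<omega>. f (\<omega> i) * f (\<omega> j) \<partial>PiM I M) = (if i = j then \<integral>x. (f x)\<^sup>2 \<partial>M i else 0)" if "i \<in> J" "j \<in> J" for i j
  proof (cases "i = j")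
    case True
    then show ?thesis
      using integral_PiM_component[where M = M, OF M _ f2[OF that(1)], of I] that J by (auto simp: power2_eq_square)
  next
    case False
    then show ?thesis
      using integral_PiM_pair_prod[where M = M and I = I, OF M fin _ _ False, of f f] f mean that J by auto
  qed
  have S2: "(S \<omega>)\<^sup>2 = (\<Sum>i\<in>J. \<Sum>j\<in>J. f (\<omega> i) * f (\<omega> j))" for \<omega>
    by (simp add: S_def power2_eq_square sum_product)
  have intS: "integrable (PiM I M) S" and ES: "P.expectation S = 0"
    using comp by (simp_all add: S_def[abs_def])
  have intS2: "integrable (PiM I M) (\<lambda>\<omega>. (S \<omega>)\<^sup>2)"
    unfolding S2 using pair by (intro Bochner_Integration.integrable_sum) auto
  have "P.expectation (\<lambda>\<omega>. (S \<omega>)\<^sup>2) = (\<Sum>i\<in>J. \<Sum>j\<in>J. if i = j then \<integral>x. (f x)\<^sup>2 \<partial>M i else 0)"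
    unfolding S2 using pair by (simp add: Bochner_Integration.integral_sum cong: sum.cong)
  also have "\<dots> = (\<Sum>i\<in>J. \<integral>x. (f x)\<^sup>2 \<partial>M i)" using finJ by simp
  also have "\<dots> \<le> real (card J) * B" using var by (rule sum_bounded_above)
  finally have "P.variance S \<le> real (card J) * B" by (simp add: ES)
  then have "P.variance S / a\<^sup>2 \<le> real (card J) * B / a\<^sup>2" by (intro divide_right_mono) auto
  moreover have "P.prob {\<omega> \<in> space (PiM I M). \<bar>S \<omega> - P.expectation S\<bar> \<ge> a} \<le> P.variance S / a\<^sup>2"
    using intS intS2 a by (intro P.Chebyshev_inequality) auto
  ultimately show ?thesis by (simp add: ES S_def)
qed

section \<open>Moments of spherical Gaussians\<close>

lemma prob_space_spherical_gaussian:
  assumes "\<sigma> > 0" shows "prob_space (spherical_gaussian m \<mu> \<sigma>)"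
  unfolding spherical_gaussian_def using assms by (intro prob_space_PiM prob_space_normal_density)

text \<open>The source of all moments used below: under a product law the expectation of a monomial
  factors into one-dimensional moments.\<close>

lemma spherical_gaussian_moments:
  fixes e :: "nat \<Rightarrow> nat"
  assumes s: "\<sigma> > 0"
  shows "integrable (spherical_gaussian m \<mu> \<sigma>) (\<lambda>x. \<Prod>l<m. (x l - \<mu> $ l) ^ e l)"
    and "(\<integral>x. (\<Prod>l<m. (x l - \<mu> $ l) ^ e l) \<partial>spherical_gaussian m \<mu> \<sigma>)
      = (\<Prod>l<m. \<integral>t. normal_density (\<mu> $ l) \<sigma> t * (t - \<mu> $ l) ^ e l \<partial>lborel)"
proof -
  interpret prob_space "density lborel (normal_density (\<mu> $ l) \<sigma>)" for l
    using s by (rule prob_space_normal_density)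
  interpret product_sigma_finite "\<lambda>l. density lborel (normal_density (\<mu> $ l) \<sigma>)" by standard
  have int: "integrable (density lborel (normal_density (\<mu> $ l) \<sigma>)) (\<lambda>t. (t - \<mu> $ l) ^ e l)" for l
    using integrable_normal_moment[OF s, of "\<mu> $ l" "e l"] by (subst integrable_density) auto
  show "integrable (spherical_gaussian m \<mu> \<sigma>) (\<lambda>x. \<Prod>l<m. (x l - \<mu> $ l) ^ e l)"
    unfolding spherical_gaussian_def
    by (rule product_integrable_prod[of "{..<m}" "\<lambda>l t. (t - \<mu> $ l) ^ e l"]) (auto intro: int)
  show "(\<integral>x. (\<Prod>l<m. (x l - \<mu> $ l) ^ e l) \<partial>spherical_gaussian m \<mu> \<sigma>)
      = (\<Prod>l<m. \<integral>t. normal_density (\<mu> $ l) \<sigma> t * (t - \<mu> $ l) ^ e l \<partial>lborel)"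
    unfolding spherical_gaussian_def
    by (subst product_integral_prod[of "{..<m}" "\<lambda>l t. (t - \<mu> $ l) ^ e l"])
       (auto intro: int simp: integral_density)
qed

lemma spherical_gaussian_first_moment:
  assumes s: "\<sigma> > 0" and i: "i < m"
  shows "integrable (spherical_gaussian m \<mu> \<sigma>) (\<lambda>x. x i - \<mu> $ i)"
    and "(\<integral>x. (x i - \<mu> $ i) \<partial>spherical_gaussian m \<mu> \<sigma>) = 0"
    and "integrable (spherical_gaussian m \<mu> \<sigma>) (\<lambda>x. (x i - \<mu> $ i)\<^sup>2)"
proof -
  have pw: "(\<Prod>l<m. (x l - \<mu> $ l) ^ (if l = i then r else 0)) = (x i - \<mu> $ i) ^ r" for x :: "nat \<Rightarrow> real" and r
  proof -
    have "(\<Prod>l<m. (x l - \<mu> $ l) ^ (if l = i then r else 0)) = (\<Prod>l<m. if l = i then (x i - \<mu> $ i) ^ r else 1)"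
      by (intro prod.cong) auto
    then show ?thesis using i by simp
  qed
  note mom = spherical_gaussian_moments[OF s, of m \<mu> "\<lambda>l. if l = i then r else 0" for r, unfolded pw]
  show "integrable (spherical_gaussian m \<mu> \<sigma>) (\<lambda>x. x i - \<mu> $ i)" using mom(1)[of 1] by simp
  show "integrable (spherical_gaussian m \<mu> \<sigma>) (\<lambda>x. (x i - \<mu> $ i)\<^sup>2)" using mom(1)[of 2] by simp
  have "(\<Prod>l<m. \<integral>t. normal_density (\<mu> $ l) \<sigma> t * (t - \<mu> $ l) ^ (if l = i then 1 else 0) \<partial>lborel) = 0"
    using integral_normal_moment_odd[OF s, of "\<mu> $ i" 0] i by (intro prod_zero) auto
  then show "(\<integral>x. (x i - \<mu> $ i) \<partial>spherical_gaussian m \<mu> \<sigma>) = 0" using mom(2)[of 1] by simp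
qed

lemma spherical_gaussian_second_moment:
  assumes s: "\<sigma> > 0" and i: "i < m" and j: "j < m"
  shows "integrable (spherical_gaussian m \<mu> \<sigma>) (\<lambda>x. (x i - \<mu> $ i) * (x j - \<mu> $ j))"
    and "(\<integral>x. (x i - \<mu> $ i) * (x j - \<mu> $ j) \<partial>spherical_gaussian m \<mu> \<sigma>) = (if i = j then \<sigma>\<^sup>2 else 0)"
    and "integrable (spherical_gaussian m \<mu> \<sigma>) (\<lambda>x. ((x i - \<mu> $ i) * (x j - \<mu> $ j))\<^sup>2)"
proof -
  \<comment> \<open>The exponents of the \<open>r\<close>-th power of the product; the two
    indicators add up when \<open>i = j\<close>. The case \<open>r = 2\<close> supplies the
    fourth-order integrability that Chebyshev's inequality requires.\<close>
  define e where "e r l = r * ((if l = i then 1 else 0) + (if l = j then 1 else 0))" for r l :: nat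
  have pw: "(\<Prod>l<m. (x l - \<mu> $ l) ^ e r l) = ((x i - \<mu> $ i) * (x j - \<mu> $ j)) ^ r" for x :: "nat \<Rightarrow> real" and r
  proof -
    have "(\<Prod>l<m. (x l - \<mu> $ l) ^ e r l)
        = (\<Prod>l<m. (if l = i then (x i - \<mu> $ i) ^ r else 1) * (if l = j then (x j - \<mu> $ j) ^ r else 1))"
      by (intro prod.cong) (auto simp: e_def power_add mult_2_right)
    then show ?thesis using i j by (simp add: prod.distrib power_mult_distrib)
  qed
  note mom = spherical_gaussian_moments[OF s, of m \<mu> "e r" for r, unfolded pw]
  show "integrable (spherical_gaussian m \<mu> \<sigma>) (\<lambda>x. (x i - \<mu> $ i) * (x j - \<mu> $ j))" using mom(1)[of 1] by simp
  show "integrable (spherical_gaussian m \<mu> \<sigma>) (\<lambda>x. ((x i - \<mu> $ i) * (x j - \<mu> $ j))\<^sup>2)" using mom(1)[of 2] by simp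
  have "(\<Prod>l<m. \<integral>t. normal_density (\<mu> $ l) \<sigma> t * (t - \<mu> $ l) ^ e 1 l \<partial>lborel) = (if i = j then \<sigma>\<^sup>2 else 0)"
  proof (cases "i = j")
    case True
    have "(\<integral>t. normal_density (\<mu> $ i) \<sigma> t * (t - \<mu> $ i) ^ 2 \<partial>lborel) = \<sigma>\<^sup>2"
      using integral_normal_moment_even[OF s, of "\<mu> $ i" 1] by (simp add: fact_numeral)
    then have "(\<Prod>l<m. \<integral>t. normal_density (\<mu> $ l) \<sigma> t * (t - \<mu> $ l) ^ e 1 l \<partial>lborel)
        = (\<Prod>l<m. if l = i then \<sigma>\<^sup>2 else 1)"
      using True s by (intro prod.cong) (auto simp: e_def numeral_2_eq_2)
    then show ?thesis using True i by simp
  next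
    case False
    \<comment> \<open>Coordinate \<open>i\<close> now has exponent 1, and a vanishing odd moment
      kills the product.\<close>
    then show ?thesis
      using integral_normal_moment_odd[OF s, of "\<mu> $ i" 0] i by (auto simp: e_def intro!: prod_zero bexI[of _ i])
  qed
  then show "(\<integral>x. (x i - \<mu> $ i) * (x j - \<mu> $ j) \<partial>spherical_gaussian m \<mu> \<sigma>) = (if i = j then \<sigma>\<^sup>2 else 0)"
    using mom(2)[of 1] by simp
qed

section \<open>Events of probability tending to one\<close>

text \<open>The witnessing events are intersected, using P(E and F) >= P(E) + P(F) - 1.\<close>

lemma with_high_probability_conj:
  assumes M: "\<And>n. prob_space (M n)"
    and "with_high_probability M A" "with_high_probability M B"
  shows "with_high_probability M (\<lambda>n \<omega>. A n \<omega> \<and> B n \<omega>)"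
proof -
  obtain E where E: "\<And>n. E n \<in> sets (M n)" "\<And>n \<omega>. \<omega> \<in> E n \<Longrightarrow> A n \<omega>" "(\<lambda>n. measure (M n) (E n)) \<longlonglongrightarrow> 1"
    using assms(2) unfolding with_high_probability_def by blast
  obtain F where F: "\<And>n. F n \<in> sets (M n)" "\<And>n \<omega>. \<omega> \<in> F n \<Longrightarrow> B n \<omega>" "(\<lambda>n. measure (M n) (F n)) \<longlonglongrightarrow> 1"
    using assms(3) unfolding with_high_probability_def by blast
  have ge: "measure (M n) (E n) + measure (M n) (F n) - 1 \<le> measure (M n) (E n \<inter> F n)" for n
  proof -
    interpret prob_space "M n" by (rule M)
    have "prob (E n \<union> F n) = prob (E n) + prob (F n) - prob (E n \<inter> F n)"
      using E(1) F(1) by (intro measure_Un3) (simp_all add: fmeasurable_eq_sets)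
    then show ?thesis using prob_le_1[of "E n \<union> F n"] by simp
  qed
  have "(\<lambda>n. measure (M n) (E n \<inter> F n)) \<longlonglongrightarrow> 1"
  proof (rule real_tendsto_sandwich)
    show "(\<lambda>n. measure (M n) (E n) + measure (M n) (F n) - 1) \<longlonglongrightarrow> 1"
      using tendsto_diff[OF tendsto_add[OF E(3) F(3)] tendsto_const[of 1]] by simp
    show "\<forall>\<^sub>F n in sequentially. measure (M n) (E n \<inter> F n) \<le> 1"
      using M prob_space.prob_le_1 by (intro always_eventually allI) blast
  qed (use ge in auto)
  then show ?thesis
    using E F unfolding with_high_probability_def by (intro exI[of _ "\<lambda>n. E n \<inter> F n"]) auto
qed

lemma with_high_probability_ball:
  assumes M: "\<And>n. prob_space (M n)" and "finite T"
    and "\<And>t. t \<in> T \<Longrightarrow> with_high_probability M (A t)"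
  shows "with_high_probability M (\<lambda>n \<omega>. \<forall>t\<in>T. A t n \<omega>)"
  using assms(2,3)
proof (induction T rule: finite_induct)
  case empty
  show ?case
    unfolding with_high_probability_def
    by (intro exI[of _ "\<lambda>n. space (M n)"]) (simp add: prob_space.prob_space[OF M])
next
  case (insert t T)
  then show ?case
    using with_high_probability_conj[where A = "A t" and B = "\<lambda>n \<omega>. \<forall>t\<in>T. A t n \<omega>", OF M] by simp
qed

lemma with_high_probability_mono:
  assumes "with_high_probability M A" and AB: "\<And>n \<omega>. n > 0 \<Longrightarrow> A n \<omega> \<Longrightarrow> B n \<omega>"
  shows "with_high_probability M B"
proof -
  obtain E where E: "\<And>n. E n \<in> sets (M n)" "\<And>n \<omega>. \<omega> \<in> E n \<Longrightarrow> A n \<omega>" "(\<lambda>n. measure (M n) (E n)) \<longlonglongrightarrow> 1"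
    using assms(1) unfolding with_high_probability_def by blast
  \<comment> \<open>At \<open>n = 0\<close>, where \<open>AB\<close> gives nothing, the event is
    replaced by the empty set; one index does not change the limit.\<close>
  define F where "F n = (if n = 0 then {} else E n)" for n
  have "(\<lambda>n. measure (M n) (F n)) \<longlonglongrightarrow> 1"
    using E(3) by (rule Lim_transform_eventually)
      (auto simp: F_def eventually_sequentially intro!: exI[of _ 1])
  then show ?thesis
    using E AB unfolding with_high_probability_def
    by (intro exI[of _ F]) (auto simp: F_def split: if_splits)
qed

lemma prob_space_mixture_sample:
  assumes "\<sigma> > 0" shows "prob_space (mixture_sample m k \<gamma> \<sigma> n)"
  unfolding mixture_sample_def by (intro prob_space_PiM prob_space_spherical_gaussian assms)

text \<open>The weak law of large numbers within one cluster: by Chebyshev the exceptional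
  probability is at most B / (\<eta>^2 n), where B is the second moment of \<open>f\<close>.\<close>

lemma with_high_probability_empirical_mean:
  assumes s: "\<sigma> > 0" and a: "a < k" and \<eta>: "\<eta> > 0"
    and f: "integrable (spherical_gaussian m (\<gamma> a) \<sigma>) f"
    and f2: "integrable (spherical_gaussian m (\<gamma> a) \<sigma>) (\<lambda>x. (f x)\<^sup>2)"
    and mean: "integral\<^sup>L (spherical_gaussian m (\<gamma> a) \<sigma>) f = 0"
  shows "with_high_probability (mixture_sample m k \<gamma> \<sigma>) (\<lambda>n \<omega>. \<bar>\<Sum>i<n. f (\<omega> (a, i))\<bar> < real n * \<eta>)"
proof -
  define Q where "Q ai = spherical_gaussian m (\<gamma> (fst ai)) \<sigma>" for ai :: "nat \<times> nat"
  define B where "B = (\<integral>x. (f x)\<^sup>2 \<partial>spherical_gaussian m (\<gamma> a) \<sigma>)"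
  define M where "M n = mixture_sample m k \<gamma> \<sigma> n" for n
  have M: "M n = PiM ({..<k} \<times> {..<n}) Q" for n
    by (simp add: M_def mixture_sample_def Q_def[abs_def])
  have Q: "prob_space (Q ai)" for ai
    unfolding Q_def by (rule prob_space_spherical_gaussian[OF s])
  define E where "E n = {\<omega> \<in> space (M n). \<bar>\<Sum>i<n. f (\<omega> (a, i))\<bar> < real n * \<eta>}" for n
  have meas: "(\<lambda>\<omega>. \<Sum>i<n. f (\<omega> (a, i))) \<in> borel_measurable (M n)" for n
  proof (rule borel_measurable_sum)
    fix i assume "i \<in> {..<n}"
    then have "(\<lambda>\<omega>. \<omega> (a, i)) \<in> measurable (M n) (Q (a, i))"
      unfolding M using a by (intro measurable_component_singleton) auto
    moreover have "f \<in> borel_measurable (Q (a, i))"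
      using f by (simp add: Q_def borel_measurable_integrable)
    ultimately show "(\<lambda>\<omega>. f (\<omega> (a, i))) \<in> borel_measurable (M n)"
      by (rule measurable_compose)
  qed
  have E: "E n \<in> sets (M n)" for n
    unfolding E_def using meas[of n] by measurable
  have ge: "1 - B / \<eta>\<^sup>2 / real n \<le> measure (M n) (E n)" if n: "n > 0" for n
  proof -
    interpret prob_space "M n" unfolding M by (intro prob_space_PiM Q)
    have sum: "(\<Sum>i\<in>{a} \<times> {..<n}. f (\<omega> i)) = (\<Sum>i<n. f (\<omega> (a, i)))" for \<omega>
      by (intro sum.reindex_bij_witness[of _ "Pair a" snd]) auto
    have "measure (M n) {\<omega> \<in> space (M n). real n * \<eta> \<le> \<bar>\<Sum>i\<in>{a} \<times> {..<n}. f (\<omega> i)\<bar>}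
        \<le> real (card ({a} \<times> {..<n})) * B / (real n * \<eta>)\<^sup>2"
      unfolding M
    proof (rule prob_PiM_sum_deviation_le[OF Q])
      show "{a} \<times> {..<n} \<subseteq> {..<k} \<times> {..<n}" using a by auto
      show "0 < real n * \<eta>" using n \<eta> by simp
    qed (use f f2 mean in \<open>auto simp: Q_def B_def\<close>)
    also have "\<dots> = B / \<eta>\<^sup>2 / real n"
      using n \<eta> by (simp add: power2_eq_square field_simps)
    also have "{\<omega> \<in> space (M n). real n * \<eta> \<le> \<bar>\<Sum>i\<in>{a} \<times> {..<n}. f (\<omega> i)\<bar>} = space (M n) - E n"
      unfolding sum E_def by auto
    finally show ?thesis using prob_compl[OF E[of n]] by simp
  qed
  have "(\<lambda>n. measure (M n) (E n)) \<longlonglongrightarrow> 1"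
  proof (rule real_tendsto_sandwich)
    show "(\<lambda>n. 1 - B / \<eta>\<^sup>2 / real n) \<longlonglongrightarrow> 1"
      using tendsto_diff[OF tendsto_const[of 1] lim_const_over_n[of "B / \<eta>\<^sup>2"]] by simp
    show "\<forall>\<^sub>F n in sequentially. 1 - B / \<eta>\<^sup>2 / real n \<le> measure (M n) (E n)"
      using ge by (auto simp: eventually_sequentially intro!: exI[of _ 1])
    show "\<forall>\<^sub>F n in sequentially. measure (M n) (E n) \<le> 1"
      using prob_space_mixture_sample[OF s] prob_space.prob_le_1
      unfolding M_def by (intro always_eventually allI) blast
  qed simp
  then show ?thesis
    unfolding with_high_probability_def M_def[symmetric]
    using E by (intro exI[of _ E]) (auto simp: E_def)
qed

text \<open>Everything after this event is deterministic. The first clause controls the empirical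
  centers, the second the entries of the empirical second-moment matrices. An entrywise tolerance of
  \<sigma>^2 / m perturbs the operator norm of an m by m matrix by at most \<sigma>^2.\<close>

definition typical_sample ::
  "nat \<Rightarrow> nat \<Rightarrow> (nat \<Rightarrow> real vec) \<Rightarrow> real \<Rightarrow> real \<Rightarrow> nat \<Rightarrow> sample \<Rightarrow> bool" where
  "typical_sample m k \<gamma> \<sigma> \<eta> n \<omega> \<longleftrightarrow>
    (\<forall>a<k. \<forall>i<m. \<bar>\<Sum>t<n. \<omega> (a, t) i - \<gamma> a $ i\<bar> < real n * \<eta>) \<and>
    (\<forall>a<k. \<forall>i<m. \<forall>j<m. \<bar>\<Sum>t<n. (\<omega> (a, t) i - \<gamma> a $ i) * (\<omega> (a, t) j - \<gamma> a $ j) - (if i = j then \<sigma>\<^sup>2 else 0)\<bar>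
        < real n * (\<sigma>\<^sup>2 / real m))"

lemma with_high_probability_typical_sample:
  assumes s: "\<sigma> > 0" and \<eta>: "\<eta> > 0" and m: "m \<ge> 1"
  shows "with_high_probability (mixture_sample m k \<gamma> \<sigma>) (typical_sample m k \<gamma> \<sigma> \<eta>)"
proof -
  let ?M = "mixture_sample m k \<gamma> \<sigma>"
  note P = prob_space_mixture_sample[OF s, of m k \<gamma>]
  have 1: "with_high_probability ?M (\<lambda>n \<omega>. \<bar>\<Sum>t<n. \<omega> (a, t) i - \<gamma> a $ i\<bar> < real n * \<eta>)" if "a < k" "i < m" for a i
    using with_high_probability_empirical_mean[OF s that(1) \<eta>, of m \<gamma> "\<lambda>x. x i - \<gamma> a $ i"]
      spherical_gaussian_first_moment[OF s that(2), of "\<gamma> a"] by simp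
  have 2: "with_high_probability ?M (\<lambda>n \<omega>. \<bar>\<Sum>t<n. (\<omega> (a, t) i - \<gamma> a $ i) * (\<omega> (a, t) j - \<gamma> a $ j) - (if i = j then \<sigma>\<^sup>2 else 0)\<bar>
        < real n * (\<sigma>\<^sup>2 / real m))" if "a < k" "i < m" "j < m" for a i j
  proof -
    interpret G: prob_space "spherical_gaussian m (\<gamma> a) \<sigma>" by (rule prob_space_spherical_gaussian[OF s])
    define v where "v = (if i = j then \<sigma>\<^sup>2 else 0)"
    define f where "f x = (x i - \<gamma> a $ i) * (x j - \<gamma> a $ j)" for x
    note mom = spherical_gaussian_second_moment[OF s that(2,3), of "\<gamma> a", folded f_def v_def]
    have "(f x - v)\<^sup>2 = (f x)\<^sup>2 - 2 * v * f x + v\<^sup>2" for x by (simp add: power2_eq_square algebra_simps)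
    then have int2: "integrable (spherical_gaussian m (\<gamma> a) \<sigma>) (\<lambda>x. (f x - v)\<^sup>2)" using mom by simp
    have "with_high_probability ?M (\<lambda>n \<omega>. \<bar>\<Sum>t<n. f (\<omega> (a, t)) - v\<bar> < real n * (\<sigma>\<^sup>2 / real m))"
      using s m mom G.prob_space int2
      by (intro with_high_probability_empirical_mean[OF s that(1), of "\<sigma>\<^sup>2 / real m" m \<gamma> "\<lambda>x. f x - v"]) auto
    then show ?thesis by (simp only: f_def v_def)
  qed
  have "with_high_probability ?M (\<lambda>n \<omega>.
      (\<forall>a\<in>{..<k}. \<forall>i\<in>{..<m}. \<bar>\<Sum>t<n. \<omega> (a, t) i - \<gamma> a $ i\<bar> < real n * \<eta>) \<and>
      (\<forall>a\<in>{..<k}. \<forall>i\<in>{..<m}. \<forall>j\<in>{..<m}. \<bar>\<Sum>t<n. (\<omega> (a, t) i - \<gamma> a $ i) * (\<omega> (a, t) j - \<gamma> a $ j) - (if i = j then \<sigma>\<^sup>2 else 0)\<bar>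
        < real n * (\<sigma>\<^sup>2 / real m)))"
    by (intro with_high_probability_conj with_high_probability_ball P finite_lessThan 1 2) auto
  then show ?thesis
    by (rule with_high_probability_mono) (auto simp: typical_sample_def)
qed

section \<open>Solutions of the semidefinite program\<close>

lemma sum_lessThan_mult:
  fixes f :: "nat \<Rightarrow> 'a::comm_monoid_add"
  shows "(\<Sum>p<k * n. f p) = (\<Sum>a<k. \<Sum>t<n. f (a * n + t))"
proof -
  have "(\<Sum>p<k * n. f p) = (\<Sum>a<k. sum f {a * n..<a * n + n})" by (rule sum.nat_group[symmetric])
  also have "\<dots> = (\<Sum>a<k. \<Sum>t<n. f (a * n + t))"
  proof (rule sum.cong[OF refl])
    fix a
    show "sum f {a * n..<a * n + n} = (\<Sum>t<n. f (a * n + t))"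
      by (rule sum.reindex_bij_witness[of _ "\<lambda>t. a * n + t" "\<lambda>p. p - a * n"]) auto
  qed
  finally show ?thesis .
qed

lemma quadratic_form_eq_bilin:
  assumes X: "X \<in> carrier_mat N N"
  shows "vec N u \<bullet> (X *\<^sub>v vec N u) = bilin {..<N} (\<lambda>p q. X $$ (p, q)) u u"
  using X by (simp add: scalar_prod_def bilin_alt atLeast0LessThan)

text \<open>The passage from matrices to the index functions in which the estimates above are
  stated.\<close>

lemma sdp_feasible_iff:
  "sdp_feasible k N X \<longleftrightarrow> X \<in> carrier_mat N N \<and> (\<Sum>p<N. X $$ (p, p)) = real k
     \<and> (\<forall>p<N. (\<Sum>q<N. X $$ (p, q)) = 1) \<and> (\<forall>p<N. \<forall>q<N. 0 \<le> X $$ (p, q))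
     \<and> (\<forall>p<N. \<forall>q<N. X $$ (p, q) = X $$ (q, p))
     \<and> (\<forall>u. 0 \<le> bilin {..<N} (\<lambda>p q. X $$ (p, q)) u u)"
proof (cases "X \<in> carrier_mat N N")
  case X: True
  have "X *\<^sub>v vec N (\<lambda>_. 1) = vec N (\<lambda>_. 1) \<longleftrightarrow> (\<forall>p<N. (\<Sum>q<N. X $$ (p, q)) = 1)"
    using X by (auto simp: vec_eq_iff scalar_prod_def atLeast0LessThan)
  moreover have "transpose_mat X = X \<longleftrightarrow> (\<forall>p<N. \<forall>q<N. X $$ (p, q) = X $$ (q, p))"
    using X by (auto simp: mat_eq_iff)
  moreover have "(\<forall>u\<in>carrier_vec N. 0 \<le> u \<bullet> (X *\<^sub>v u)) \<longleftrightarrow> (\<forall>u. 0 \<le> bilin {..<N} (\<lambda>p q. X $$ (p, q)) u u)"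
  proof (intro iffI allI ballI)
    fix u assume "\<forall>u\<in>carrier_vec N. 0 \<le> u \<bullet> (X *\<^sub>v u)"
    then show "0 \<le> bilin {..<N} (\<lambda>p q. X $$ (p, q)) u u"
      unfolding quadratic_form_eq_bilin[OF X, symmetric] by simp
  next
    fix u :: "real vec" assume *: "\<forall>u. 0 \<le> bilin {..<N} (\<lambda>p q. X $$ (p, q)) u u" and u: "u \<in> carrier_vec N"
    have "u = vec N (\<lambda>i. u $ i)" using u by auto
    then show "0 \<le> u \<bullet> (X *\<^sub>v u)"
      using *[rule_format, of "\<lambda>i. u $ i"] unfolding quadratic_form_eq_bilin[OF X, symmetric] by simp
  qed
  ultimately show ?thesis
    using X by (auto simp: sdp_feasible_def psd_def mat_trace_def)
qed (simp add: sdp_feasible_def)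

text \<open>Expanding the squared distances, unit row and column sums make the two pure square terms
  independent of \<open>X\<close>; minimizing Tr(DX) thus means maximizing Tr(PXP^T).\<close>

lemma mat_trace_sq_dist_mat:
  assumes P: "P \<in> carrier_mat m N" and X: "X \<in> carrier_mat N N"
    and sym: "\<forall>p<N. \<forall>q<N. X $$ (p, q) = X $$ (q, p)"
    and row: "\<forall>p<N. (\<Sum>q<N. X $$ (p, q)) = 1"
  shows "mat_trace (sq_dist_mat P * X) = 2 * (\<Sum>j<m. \<Sum>p<N. (P $$ (j, p))\<^sup>2)
     - 2 * (\<Sum>j<m. bilin {..<N} (\<lambda>p q. X $$ (p, q)) (\<lambda>p. P $$ (j, p)) (\<lambda>p. P $$ (j, p)))"
proof -
  have D: "sq_dist_mat P $$ (p, q) = (\<Sum>j<m. (P $$ (j, p) - P $$ (j, q))\<^sup>2)" if "p < N" "q < N" for p q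
  proof -
    have "(vnorm (col P p - col P q))\<^sup>2 = (\<Sum>j<m. (P $$ (j, p) - P $$ (j, q))\<^sup>2)"
      using P that by (simp add: vnorm_eq_L2_set L2_set_def sum_nonneg)
    then show ?thesis using P that by (simp add: sq_dist_mat_def)
  qed
  have sum1: "(\<Sum>p<N. \<Sum>q<N. X $$ (p, q) * (P $$ (j, p))\<^sup>2) = (\<Sum>p<N. (P $$ (j, p))\<^sup>2)" for j
    using row by (simp add: sum_distrib_right[symmetric])
  have sum2: "(\<Sum>p<N. \<Sum>q<N. X $$ (p, q) * (P $$ (j, q))\<^sup>2) = (\<Sum>p<N. (P $$ (j, p))\<^sup>2)" for j
    by (subst sum1[symmetric], subst sum.swap) (use sym in \<open>auto intro!: sum.cong\<close>)
  have "mat_trace (sq_dist_mat P * X) = (\<Sum>p<N. \<Sum>q<N. sq_dist_mat P $$ (p, q) * X $$ (q, p))"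
    using P X by (simp add: mat_trace_def sq_dist_mat_def scalar_prod_def atLeast0LessThan)
  also have "\<dots> = (\<Sum>p<N. \<Sum>q<N. \<Sum>j<m. X $$ (p, q) * (P $$ (j, p) - P $$ (j, q))\<^sup>2)"
    using sym by (intro sum.cong refl) (simp add: D sum_distrib_right sum_distrib_left mult.commute)
  also have "\<dots> = (\<Sum>p<N. \<Sum>j<m. \<Sum>q<N. X $$ (p, q) * (P $$ (j, p) - P $$ (j, q))\<^sup>2)"
    by (intro sum.cong refl sum.swap)
  also have "\<dots> = (\<Sum>j<m. \<Sum>p<N. \<Sum>q<N. X $$ (p, q) * (P $$ (j, p) - P $$ (j, q))\<^sup>2)"
    by (rule sum.swap)
  also have "\<dots> = (\<Sum>j<m. (\<Sum>p<N. \<Sum>q<N. X $$ (p, q) * (P $$ (j, p))\<^sup>2)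
      + (\<Sum>p<N. \<Sum>q<N. X $$ (p, q) * (P $$ (j, q))\<^sup>2)
      - 2 * (\<Sum>p<N. \<Sum>q<N. X $$ (p, q) * P $$ (j, p) * P $$ (j, q)))"
    unfolding sum_distrib_left sum.distrib[symmetric] sum_subtractf[symmetric]
    by (intro sum.cong refl) (simp add: power2_eq_square algebra_simps)
  also have "\<dots> = (\<Sum>j<m. 2 * (\<Sum>p<N. (P $$ (j, p))\<^sup>2)
      - 2 * bilin {..<N} (\<lambda>p q. X $$ (p, q)) (\<lambda>p. P $$ (j, p)) (\<lambda>p. P $$ (j, p)))"
    by (simp add: sum1 sum2 bilin_def)
  finally show ?thesis by (simp add: sum_subtractf sum_distrib_left)
qed

text \<open>The orthogonal projection onto the vectors that are constant on the true clusters; it is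
  the competitor against which the minimizer is tested.\<close>

definition cluster_mat :: "nat \<Rightarrow> nat \<Rightarrow> real mat" where
  "cluster_mat k n = mat (k * n) (k * n) (\<lambda>(p, q). if p div n = q div n then 1 / real n else 0)"

lemma sum_same_cluster:
  assumes n: "n > 0" and p: "p < k * n"
  shows "(\<Sum>q<k * n. (if p div n = q div n then 1 / real n else 0) * v q)
    = (\<Sum>t<n. v (p div n * n + t)) / real n"
proof -
  have "(\<Sum>q<k * n. (if p div n = q div n then 1 / real n else 0) * v q)
      = (\<Sum>b<k. if b = p div n then (\<Sum>t<n. v (b * n + t)) / real n else 0)"
    unfolding sum_lessThan_mult
  proof (intro sum.cong refl)
    fix b
    have "(\<Sum>t<n. (if p div n = (b * n + t) div n then 1 / real n else 0) * v (b * n + t))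
        = (\<Sum>t<n. if b = p div n then v (b * n + t) / real n else 0)"
      using n by (intro sum.cong refl) auto
    then show "(\<Sum>t<n. (if p div n = (b * n + t) div n then 1 / real n else 0) * v (b * n + t))
        = (if b = p div n then (\<Sum>t<n. v (b * n + t)) / real n else 0)"
      by (simp add: sum_divide_distrib)
  qed
  also have "\<dots> = (\<Sum>t<n. v (p div n * n + t)) / real n"
    using less_mult_imp_div_less[OF p] by simp
  finally show ?thesis .
qed

text \<open>Applying the matrix replaces each entry by its cluster mean. The sum of squares gives
  positive semidefiniteness and identifies the competitor's objective with the squared norm of the
  centers.\<close>

lemma bilin_cluster_mat:
  assumes n: "n > 0"
  shows "bilin {..<k * n} (\<lambda>p q. cluster_mat k n $$ (p, q)) v v = (\<Sum>a<k. (\<Sum>t<n. v (a * n + t))\<^sup>2 / real n)"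
proof -
  have "bilin {..<k * n} (\<lambda>p q. cluster_mat k n $$ (p, q)) v v
      = (\<Sum>p<k * n. v p * ((\<Sum>t<n. v (p div n * n + t)) / real n))"
    unfolding bilin_alt
    by (intro sum.cong refl) (simp add: cluster_mat_def sum_same_cluster[OF n, symmetric])
  also have "\<dots> = (\<Sum>a<k. \<Sum>t<n. v (a * n + t) * ((\<Sum>t<n. v (a * n + t)) / real n))"
    unfolding sum_lessThan_mult using n by (intro sum.cong refl) simp
  also have "\<dots> = (\<Sum>a<k. (\<Sum>t<n. v (a * n + t))\<^sup>2 / real n)"
    unfolding sum_distrib_right[symmetric] by (simp add: power2_eq_square)
  finally show ?thesis .
qed

lemma sdp_feasible_cluster_mat:
  assumes n: "n > 0"
  shows "sdp_feasible k (k * n) (cluster_mat k n)"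
  unfolding sdp_feasible_iff
proof (intro conjI allI impI)
  show "cluster_mat k n \<in> carrier_mat (k * n) (k * n)" by (simp add: cluster_mat_def)
  show "(\<Sum>p<k * n. cluster_mat k n $$ (p, p)) = real k"
    using n by (simp add: cluster_mat_def)
  show "(\<Sum>q<k * n. cluster_mat k n $$ (p, q)) = 1" if "p < k * n" for p
    using sum_same_cluster[OF n that, of "\<lambda>_. 1"] that n by (simp add: cluster_mat_def)
  show "0 \<le> cluster_mat k n $$ (p, q)" "cluster_mat k n $$ (p, q) = cluster_mat k n $$ (q, p)"
    if "p < k * n" "q < k * n" for p q using that by (auto simp: cluster_mat_def)
  show "0 \<le> bilin {..<k * n} (\<lambda>p q. cluster_mat k n $$ (p, q)) u u" for u
    unfolding bilin_cluster_mat[OF n] by (intro sum_nonneg) simp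
qed

section \<open>Noise in a typical sample\<close>

lemma emp_center_nth: "j < m \<Longrightarrow> emp_center m n \<omega> a $ j = (\<Sum>t<n. \<omega> (a, t) j) / real n"
  by (simp add: emp_center_def point_def)

lemma data_mat_nth:
  "j < m \<Longrightarrow> p < k * n \<Longrightarrow> data_mat m k n \<omega> $$ (j, p) = \<omega> (p div n, p mod n) j"
  by (simp add: data_mat_def point_def)

text \<open>Expanding around the mean \<mu> leaves the surplus n (\<mu> - c)^2. This permits
  replacing empirical centers by the true ones in noise bounds.\<close>

lemma sum_sq_mean_deviation_le:
  fixes w :: "nat \<Rightarrow> real"
  assumes n: "n > 0"
  shows "(\<Sum>t<n. (w t - (\<Sum>s<n. w s) / real n)\<^sup>2) \<le> (\<Sum>t<n. (w t - c)\<^sup>2)"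
proof -
  define \<mu> where "\<mu> = (\<Sum>s<n. w s) / real n"
  have "(\<Sum>t<n. (w t - c)\<^sup>2) = (\<Sum>t<n. (w t - \<mu>)\<^sup>2 + (2 * (\<mu> - c) * w t + (c\<^sup>2 - \<mu>\<^sup>2)))"
    by (intro sum.cong refl) (simp add: power2_eq_square algebra_simps)
  also have "\<dots> = (\<Sum>t<n. (w t - \<mu>)\<^sup>2) + (2 * (\<mu> - c) * (\<Sum>t<n. w t) + real n * (c\<^sup>2 - \<mu>\<^sup>2))"
    by (simp only: sum.distrib sum_distrib_left sum_constant card_lessThan)
  also have "(\<Sum>t<n. w t) = real n * \<mu>" using n by (simp add: \<mu>_def)
  also have "2 * (\<mu> - c) * (real n * \<mu>) + real n * (c\<^sup>2 - \<mu>\<^sup>2) = real n * (\<mu> - c)\<^sup>2"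
    by (simp add: power2_eq_square algebra_simps)
  finally show ?thesis by (simp add: \<mu>_def)
qed

text \<open>Recentering at the true mean only increases the sum, which then is a quadratic form in
  the empirical second moments. Their expectation and their deviation each contribute \<sigma>^2 n
  |u|^2, hence the factor 2.\<close>

lemma typical_sample_noise_le:
  assumes typical: "typical_sample m k \<gamma> \<sigma> \<eta> n \<omega>" and a: "a < k" and m: "m \<ge> 1" and n: "n > 0"
  shows "(\<Sum>t<n. (\<Sum>j<m. u j * (\<omega> (a, t) j - emp_center m n \<omega> a $ j))\<^sup>2) \<le> 2 * \<sigma>\<^sup>2 * real n * (\<Sum>j<m. (u j)\<^sup>2)"
proof -
  define w where "w t j = \<omega> (a, t) j - \<gamma> a $ j" for t j
  define W where "W t = (\<Sum>j<m. u j * \<omega> (a, t) j)" for t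
  define c where "c = (\<Sum>j<m. u j * \<gamma> a $ j)"
  have W_mean: "(\<Sum>j<m. u j * emp_center m n \<omega> a $ j) = (\<Sum>s<n. W s) / real n"
  proof -
    have "(\<Sum>j<m. u j * emp_center m n \<omega> a $ j) = (\<Sum>j<m. \<Sum>t<n. u j * \<omega> (a, t) j / real n)"
      by (intro sum.cong refl) (simp add: emp_center_nth sum_distrib_left sum_divide_distrib)
    also have "\<dots> = (\<Sum>t<n. \<Sum>j<m. u j * \<omega> (a, t) j / real n)" by (rule sum.swap)
    finally show ?thesis by (simp add: W_def sum_divide_distrib)
  qed
  have "(\<Sum>t<n. (\<Sum>j<m. u j * (\<omega> (a, t) j - emp_center m n \<omega> a $ j))\<^sup>2)
      = (\<Sum>t<n. (W t - (\<Sum>s<n. W s) / real n)\<^sup>2)"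
    by (simp add: right_diff_distrib sum_subtractf W_mean) (simp add: W_def)
  also have "\<dots> \<le> (\<Sum>t<n. (W t - c)\<^sup>2)" by (rule sum_sq_mean_deviation_le[OF n])
  also have "\<dots> = (\<Sum>t<n. (\<Sum>j<m. u j * w t j)\<^sup>2)"
    by (simp add: W_def c_def w_def right_diff_distrib sum_subtractf)
  also have "\<dots> = (\<Sum>i<m. \<Sum>j<m. u i * u j * (\<Sum>t<n. w t i * w t j))"
  proof -
    have "(\<Sum>t<n. (\<Sum>j<m. u j * w t j)\<^sup>2) = (\<Sum>t<n. \<Sum>i<m. \<Sum>j<m. u i * u j * (w t i * w t j))"
      by (simp add: power2_eq_square sum_product mult_ac)
    also have "\<dots> = (\<Sum>i<m. \<Sum>t<n. \<Sum>j<m. u i * u j * (w t i * w t j))" by (rule sum.swap)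
    also have "\<dots> = (\<Sum>i<m. \<Sum>j<m. \<Sum>t<n. u i * u j * (w t i * w t j))"
      by (intro sum.cong refl sum.swap)
    finally show ?thesis by (simp add: sum_distrib_left)
  qed
  also have "\<dots> \<le> (\<Sum>i<m. \<Sum>j<m. (if i = j then real n * \<sigma>\<^sup>2 * (u i)\<^sup>2 else 0) + (\<bar>u i\<bar> * \<bar>u j\<bar>) * (real n * (\<sigma>\<^sup>2 / real m)))"
  proof (intro sum_mono)
    fix i j assume ij: "i \<in> {..<m}" "j \<in> {..<m}"
    define e where "e = (\<Sum>t<n. w t i * w t j) - real n * (if i = j then \<sigma>\<^sup>2 else 0)"
    have "\<bar>\<Sum>t<n. w t i * w t j - (if i = j then \<sigma>\<^sup>2 else 0)\<bar> < real n * (\<sigma>\<^sup>2 / real m)"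
      using typical a ij unfolding typical_sample_def w_def by blast
    then have "\<bar>e\<bar> \<le> real n * (\<sigma>\<^sup>2 / real m)"
      by (simp add: e_def sum_subtractf)
    then have "\<bar>u i * u j\<bar> * \<bar>e\<bar> \<le> \<bar>u i * u j\<bar> * (real n * (\<sigma>\<^sup>2 / real m))"
      by (rule mult_left_mono) simp
    then have "u i * u j * e \<le> \<bar>u i\<bar> * \<bar>u j\<bar> * (real n * (\<sigma>\<^sup>2 / real m))"
      using abs_ge_self[of "u i * u j * e"] by (simp add: abs_mult)
    moreover have "u i * u j * (\<Sum>t<n. w t i * w t j) = u i * u j * e + (if i = j then real n * \<sigma>\<^sup>2 * (u i)\<^sup>2 else 0)"
      by (simp add: e_def power2_eq_square algebra_simps)
    ultimately show "u i * u j * (\<Sum>t<n. w t i * w t j)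
        \<le> (if i = j then real n * \<sigma>\<^sup>2 * (u i)\<^sup>2 else 0) + (\<bar>u i\<bar> * \<bar>u j\<bar>) * (real n * (\<sigma>\<^sup>2 / real m))"
      by linarith
  qed
  also have "\<dots> = real n * \<sigma>\<^sup>2 * (\<Sum>j<m. (u j)\<^sup>2) + (\<Sum>j<m. \<bar>u j\<bar>)\<^sup>2 * (real n * (\<sigma>\<^sup>2 / real m))"
  proof -
    have "(\<Sum>j<m. \<bar>u j\<bar>)\<^sup>2 * c = (\<Sum>i<m. \<Sum>j<m. (\<bar>u i\<bar> * \<bar>u j\<bar>) * c)" for c
      unfolding power2_eq_square sum_product by (simp only: sum_distrib_right)
    then show ?thesis unfolding sum.distrib by (simp add: sum_distrib_left sum_divide_distrib)
  qed
  \<comment> \<open>Cauchy-Schwarz costs a factor m, which cancels the 1/m in the entrywise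
    tolerance.\<close>
  also have "\<dots> \<le> real n * \<sigma>\<^sup>2 * (\<Sum>j<m. (u j)\<^sup>2) + real m * (\<Sum>j<m. (u j)\<^sup>2) * (real n * (\<sigma>\<^sup>2 / real m))"
    using Cauchy_Schwarz_ineq_sum[of "\<lambda>_. 1" "\<lambda>j. \<bar>u j\<bar>" "{..<m}"]
    by (intro add_left_mono mult_right_mono) auto
  also have "\<dots> = 2 * \<sigma>\<^sup>2 * real n * (\<Sum>j<m. (u j)\<^sup>2)"
    using m by simp
  finally show ?thesis .
qed

lemma vnorm_emp_center_le:
  assumes typical: "typical_sample m k \<gamma> \<sigma> \<eta> n \<omega>" and a: "a < k" and n: "n > 0" and c: "\<gamma> a \<in> carrier_vec m"
  shows "vnorm (emp_center m n \<omega> a - \<gamma> a) \<le> real m * \<eta>"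
proof -
  have "vnorm (emp_center m n \<omega> a - \<gamma> a) = L2_set (\<lambda>j. emp_center m n \<omega> a $ j - \<gamma> a $ j) {..<m}"
    unfolding vnorm_eq_L2_set using c by (intro L2_set_cong) (auto simp: emp_center_def)
  also have "\<dots> \<le> (\<Sum>j<m. \<bar>emp_center m n \<omega> a $ j - \<gamma> a $ j\<bar>)" by (rule L2_set_le_sum_abs)
  also have "\<dots> \<le> (\<Sum>j<m. \<eta>)"
  proof (intro sum_mono)
    fix j assume j: "j \<in> {..<m}"
    have "emp_center m n \<omega> a $ j - \<gamma> a $ j = (\<Sum>t<n. \<omega> (a, t) j - \<gamma> a $ j) / real n"
      using j n by (simp add: emp_center_nth sum_subtractf field_simps)
    moreover have "\<bar>\<Sum>t<n. \<omega> (a, t) j - \<gamma> a $ j\<bar> < real n * \<eta>"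
      using typical a j by (simp add: typical_sample_def)
    ultimately show "\<bar>emp_center m n \<omega> a $ j - \<gamma> a $ j\<bar> \<le> \<eta>"
      using n by (simp add: abs_divide pos_divide_le_eq mult.commute)
  qed
  finally show ?thesis by simp
qed

text \<open>\<open>denoising_bound\<close> is applied with L = 2 \<sigma>^2 n k, the sum of the
  noise bounds of the k clusters; its factor 14 k turns this into 28 \<sigma>^2 n k^2.\<close>

lemma sdp_denoising_bound:
  assumes typical: "typical_sample m k \<gamma> \<sigma> \<eta> n \<omega>" and m: "m \<ge> 1" and n: "n > 0"
    and X: "sdp_minimizer k (k * n) (sq_dist_mat (data_mat m k n \<omega>)) X"
  shows "(\<Sum>p<k * n. (vnorm (col (data_mat m k n \<omega> * X) p - emp_center m n \<omega> (p div n)))\<^sup>2)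
     \<le> 28 * \<sigma>\<^sup>2 * real n * (real k)\<^sup>2"
proof -
  define P where "P = data_mat m k n \<omega>"
  define x where "x j p = P $$ (j, p)" for j p
  define g where "g a j = emp_center m n \<omega> a $ j" for a j
  define Xf where "Xf p q = X $$ (p, q)" for p q
  have P: "P \<in> carrier_mat m (k * n)" by (simp add: P_def data_mat_def)
  have feas: "sdp_feasible k (k * n) X" and opt: "mat_trace (sq_dist_mat P * X) \<le> mat_trace (sq_dist_mat P * cluster_mat k n)"
    using X sdp_feasible_cluster_mat[OF n] by (auto simp: sdp_minimizer_def P_def)
  note F = feas[unfolded sdp_feasible_iff] and C = sdp_feasible_cluster_mat[OF n, of k, unfolded sdp_feasible_iff]
  have Xc: "X \<in> carrier_mat (k * n) (k * n)" using F by simp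
  have x: "x j (a * n + t) = \<omega> (a, t) j" if "j < m" "a < k" "t < n" for j a t
  proof -
    have "a * n + t < Suc a * n" using that by simp
    also have "\<dots> \<le> k * n" using that by (intro mult_right_mono) auto
    finally show ?thesis using that by (simp add: x_def P_def data_mat_nth)
  qed
  have mean: "(\<Sum>t<n. x j (a * n + t)) = real n * g a j" if "j < m" "a < k" for j a
    using that n x by (simp add: g_def emp_center_nth)
  have "(\<Sum>p\<in>{..<k * n}. \<Sum>j\<in>{..<m}. ((\<Sum>q\<in>{..<k * n}. Xf p q * x j q) - g (p div n) j)\<^sup>2)
      \<le> 14 * (2 * \<sigma>\<^sup>2 * real n * real k) * real (card {..<k})"
  proof (rule denoising_bound)
    show "(\<lambda>p. p div n) ` {..<k * n} \<subseteq> {..<k}" by (auto intro: less_mult_imp_div_less)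
    show "(\<Sum>p<k * n. g (p div n) j * (x j p - g (p div n) j)) = 0" if "j \<in> {..<m}" for j
    proof -
      have "(\<Sum>p<k * n. g (p div n) j * (x j p - g (p div n) j))
          = (\<Sum>a<k. \<Sum>t<n. g a j * (x j (a * n + t) - g a j))"
        unfolding sum_lessThan_mult using n by (intro sum.cong refl) simp
      also have "\<dots> = 0"
        using mean that by (intro sum.neutral[of "{..<k}"] ballI) (simp add: sum_distrib_left[symmetric] sum_subtractf)
      finally show ?thesis .
    qed
    \<comment> \<open>The left side is the competitor's value of Tr(PXP^T), so this is optimality of
      \<open>X\<close> rewritten by \<open>mat_trace_sq_dist_mat\<close>.\<close>
    show "(\<Sum>j<m. \<Sum>p<k * n. (g (p div n) j)\<^sup>2) \<le> (\<Sum>j<m. bilin {..<k * n} Xf (x j) (x j))"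
    proof -
      have "(\<Sum>p<k * n. (g (p div n) j)\<^sup>2) = bilin {..<k * n} (\<lambda>p q. cluster_mat k n $$ (p, q)) (x j) (x j)" if "j < m" for j
      proof -
        have "(\<Sum>p<k * n. (g (p div n) j)\<^sup>2) = (\<Sum>a<k. \<Sum>t<n. (g a j)\<^sup>2)"
          unfolding sum_lessThan_mult using n by (intro sum.cong refl) simp
        also have "\<dots> = (\<Sum>a<k. (\<Sum>t<n. x j (a * n + t))\<^sup>2 / real n)"
          using mean that n by (intro sum.cong refl) (simp add: power2_eq_square)
        finally show ?thesis by (simp add: bilin_cluster_mat[OF n])
      qed
      moreover have "(\<Sum>j<m. bilin {..<k * n} (\<lambda>p q. cluster_mat k n $$ (p, q)) (x j) (x j))
          \<le> (\<Sum>j<m. bilin {..<k * n} Xf (x j) (x j))"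
        using opt F C mat_trace_sq_dist_mat[OF P] by (simp add: x_def[abs_def] Xf_def[abs_def])
      ultimately show ?thesis by simp
    qed
    show "(\<Sum>p<k * n. (\<Sum>j<m. u j * (x j p - g (p div n) j))\<^sup>2) \<le> 2 * \<sigma>\<^sup>2 * real n * real k * (\<Sum>j<m. (u j)\<^sup>2)" for u
    proof -
      have "(\<Sum>p<k * n. (\<Sum>j<m. u j * (x j p - g (p div n) j))\<^sup>2)
          = (\<Sum>a<k. \<Sum>t<n. (\<Sum>j<m. u j * (\<omega> (a, t) j - emp_center m n \<omega> a $ j))\<^sup>2)"
        unfolding sum_lessThan_mult using n x by (intro sum.cong refl) (simp add: g_def)
      also have "\<dots> \<le> (\<Sum>a<k. 2 * \<sigma>\<^sup>2 * real n * (\<Sum>j<m. (u j)\<^sup>2))"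
        by (intro sum_mono typical_sample_noise_le[OF typical _ m n]) simp
      finally show ?thesis by (simp add: mult_ac)
    qed
  qed (use F in \<open>auto simp: Xf_def[abs_def]\<close>)
  moreover have "(vnorm (col (P * X) p - emp_center m n \<omega> (p div n)))\<^sup>2
      = (\<Sum>j<m. ((\<Sum>q<k * n. Xf p q * x j q) - g (p div n) j)\<^sup>2)" if p: "p < k * n" for p
  proof -
    have "(P * X) $$ (j, p) = (\<Sum>q<k * n. Xf p q * x j q)" if "j < m" for j
    proof -
      have "(P * X) $$ (j, p) = (\<Sum>q<k * n. P $$ (j, q) * X $$ (q, p))"
        using P Xc p that by (simp add: scalar_prod_def atLeast0LessThan)
      also have "\<dots> = (\<Sum>q<k * n. Xf p q * x j q)"
        using F p by (intro sum.cong refl) (simp add: Xf_def x_def)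
      finally show ?thesis .
    qed
    moreover have "dim_vec (emp_center m n \<omega> b) = m" for b by (simp add: emp_center_def)
    ultimately show ?thesis
      using P Xc p by (simp add: vnorm_eq_L2_set L2_set_def sum_nonneg g_def)
  qed
  ultimately show ?thesis by (simp add: P_def[symmetric] power2_eq_square mult_ac)
qed

section \<open>Recovery of the centers\<close>

lemma abs_vec_nth_le_vnorm:
  assumes "i < dim_vec v"
  shows "\<bar>v $ i\<bar> \<le> vnorm v"
  using member_le_L2_set[of "{..<dim_vec v}" i "\<lambda>i. \<bar>v $ i\<bar>"] assms
  by (simp add: vnorm_eq_L2_set L2_set_def)

text \<open>A real supremum dominates its members only over a bounded set. Vectors of the unit ball
  have coordinates of modulus at most 1, so the absolute entries of \<open>A\<close> sum to a
  bound.\<close>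

lemma vnorm_mult_le_spectral_norm:
  assumes A: "A \<in> carrier_mat r c" and u: "u \<in> carrier_vec c" "vnorm u \<le> 1"
  shows "vnorm (A *\<^sub>v u) \<le> spectral_norm A"
  unfolding spectral_norm_def
proof (rule cSUP_upper)
  show "u \<in> {u \<in> carrier_vec (dim_col A). vnorm u \<le> 1}" using A u by simp
  show "bdd_above ((\<lambda>u. vnorm (A *\<^sub>v u)) ` {u \<in> carrier_vec (dim_col A). vnorm u \<le> 1})"
  proof (rule bdd_aboveI2)
    fix v assume "v \<in> {u \<in> carrier_vec (dim_col A). vnorm u \<le> 1}"
    then have v: "v \<in> carrier_vec c" "vnorm v \<le> 1" using A by auto
    have le1: "\<bar>v $ j\<bar> \<le> 1" if "j < c" for j
      using abs_vec_nth_le_vnorm[of j v] that v by simp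
    have "vnorm (A *\<^sub>v v) \<le> (\<Sum>i<r. \<bar>(A *\<^sub>v v) $ i\<bar>)"
      using A L2_set_le_sum_abs[of "\<lambda>i. (A *\<^sub>v v) $ i" "{..<r}"] by (simp add: vnorm_eq_L2_set)
    also have "\<dots> \<le> (\<Sum>i<r. \<Sum>j<c. \<bar>A $$ (i, j)\<bar>)"
    proof (rule sum_mono)
      fix i assume i: "i \<in> {..<r}"
      have "\<bar>(A *\<^sub>v v) $ i\<bar> = \<bar>\<Sum>j<c. A $$ (i, j) * v $ j\<bar>"
        using A v i by (simp add: scalar_prod_def atLeast0LessThan)
      also have "\<dots> \<le> (\<Sum>j<c. \<bar>A $$ (i, j) * v $ j\<bar>)" by (rule sum_abs)
      also have "\<dots> \<le> (\<Sum>j<c. \<bar>A $$ (i, j)\<bar>)"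
        using le1 by (intro sum_mono) (simp add: abs_mult mult_left_le)
      finally show "\<bar>(A *\<^sub>v v) $ i\<bar> \<le> (\<Sum>j<c. \<bar>A $$ (i, j)\<bar>)" .
    qed
    finally show "vnorm (A *\<^sub>v v) \<le> (\<Sum>i<r. \<Sum>j<c. \<bar>A $$ (i, j)\<bar>)" .
  qed
qed

text \<open>The test vector is half the difference of the unit vectors at \<open>a\<close> and
  \<open>b\<close>, of norm sqrt(1/2). The overall mean subtracted from every column of
  \<open>\<Gamma>_mat\<close> cancels.\<close>

lemma vnorm_emp_center_diff_le_spectral_norm:
  assumes ab: "a < k" "b < k" "a \<noteq> b"
  shows "vnorm (emp_center m n \<omega> a - emp_center m n \<omega> b) / 2 \<le> spectral_norm (\<Gamma>_mat m k n \<omega>)"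
proof -
  define w where "w i = (if i = a then 1/2 else if i = b then - 1/2 else 0 :: real)" for i
  have sum_w: "(\<Sum>i<k. f i * w i) = (f a - f b) / 2" for f
  proof -
    have "(\<Sum>i<k. f i * w i) = (\<Sum>i<k. (if i = a then f a / 2 else 0) - (if i = b then f b / 2 else 0))"
      using ab by (intro sum.cong refl) (auto simp: w_def)
    then show ?thesis using ab by (simp add: sum_subtractf)
  qed
  have \<Gamma>: "\<Gamma>_mat m k n \<omega> \<in> carrier_mat m k" by (simp add: \<Gamma>_mat_def)
  have "vnorm (vec k w) = L2_set w {..<k}"
    unfolding vnorm_eq_L2_set by (intro L2_set_cong) auto
  also have "\<dots> = sqrt (\<Sum>i<k. w i * w i)" by (simp add: L2_set_def power2_eq_square)
  also have "\<dots> \<le> 1" using ab by (simp only: sum_w) (simp add: w_def)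
  finally have "vnorm (\<Gamma>_mat m k n \<omega> *\<^sub>v vec k w) \<le> spectral_norm (\<Gamma>_mat m k n \<omega>)"
    by (intro vnorm_mult_le_spectral_norm[OF \<Gamma>]) auto
  moreover have "vnorm (\<Gamma>_mat m k n \<omega> *\<^sub>v vec k w)
      = L2_set (\<lambda>j. (emp_center m n \<omega> a $ j - emp_center m n \<omega> b $ j) * (1/2)) {..<m}"
    unfolding vnorm_eq_L2_set
  proof (intro L2_set_cong)
    fix j assume j: "j \<in> {..<m}"
    have "(\<Gamma>_mat m k n \<omega> *\<^sub>v vec k w) $ j = (\<Sum>i<k. \<Gamma>_mat m k n \<omega> $$ (j, i) * w i)"
      using \<Gamma> j by (simp add: scalar_prod_def atLeast0LessThan)
    also have "\<dots> = (emp_center m n \<omega> a $ j - emp_center m n \<omega> b $ j) * (1/2)"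
      unfolding sum_w using ab j by (simp add: \<Gamma>_mat_def)
    finally show "(\<Gamma>_mat m k n \<omega> *\<^sub>v vec k w) $ j = \<dots>" .
  qed (use \<Gamma> in simp)
  moreover have "\<dots> = L2_set (\<lambda>j. emp_center m n \<omega> a $ j - emp_center m n \<omega> b $ j) {..<m} * (1/2)"
    by (rule L2_set_left_distrib[symmetric]) simp
  moreover have "L2_set (\<lambda>j. emp_center m n \<omega> a $ j - emp_center m n \<omega> b $ j) {..<m}
      = vnorm (emp_center m n \<omega> a - emp_center m n \<omega> b)"
    unfolding vnorm_eq_L2_set by (intro L2_set_cong) (auto simp: emp_center_def)
  ultimately show ?thesis by simp
qed

section \<open>The minimal distance between the true centers\<close>

lemma finite_center_distances:
  "finite {vnorm (\<gamma> a - \<gamma> b) | a b. a < k \<and> b < k \<and> a \<noteq> (b::nat)}"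
  by (rule finite_subset[of _ "(\<lambda>(a, b). vnorm (\<gamma> a - \<gamma> b)) ` ({..<k} \<times> {..<k})"]) auto

lemma \<Delta>_min_le:
  assumes "a < k" "b < k" "a \<noteq> b"
  shows "\<Delta>_min k \<gamma> \<le> vnorm (\<gamma> a - \<gamma> b)"
  unfolding \<Delta>_min_def using assms by (intro Min_le finite_center_distances) auto

lemma vnorm_diff_pos:
  assumes "u \<in> carrier_vec m" "v \<in> carrier_vec m" "u \<noteq> v"
  shows "vnorm (u - v) > 0"
proof -
  obtain i where i: "i < m" "u $ i \<noteq> v $ i" using assms by (metis carrier_vecD eq_vecI)
  have "0 < \<bar>(u - v) $ i\<bar>" using assms i by simp
  also have "\<dots> \<le> vnorm (u - v)"
    using assms i by (intro abs_vec_nth_le_vnorm) auto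
  finally show ?thesis .
qed

lemma \<Delta>_min_pos:
  assumes "k \<ge> 2" and c: "\<forall>a<k. \<gamma> a \<in> carrier_vec m" and inj: "inj_on \<gamma> {..<k}"
  shows "\<Delta>_min k \<gamma> > 0"
proof -
  have "vnorm (\<gamma> 0 - \<gamma> 1) \<in> {vnorm (\<gamma> a - \<gamma> b) | a b. a < k \<and> b < k \<and> a \<noteq> b}"
    using assms(1) by force
  then have ne: "{vnorm (\<gamma> a - \<gamma> b) | a b. a < k \<and> b < k \<and> a \<noteq> b} \<noteq> {}" by blast
  obtain a b where "\<Delta>_min k \<gamma> = vnorm (\<gamma> a - \<gamma> b)" "a < k" "b < k" "a \<noteq> b"
    using Min_in[OF finite_center_distances ne] unfolding \<Delta>_min_def by blast
  then show ?thesis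
    using vnorm_diff_pos[of "\<gamma> a" m "\<gamma> b"] c inj by (auto simp: inj_on_def)
qed

text \<open>The balance of constants: S >= 1/4 makes \<epsilon> = 40 S k \<sigma> at least 10 k
  \<sigma>, large enough for few bad columns, while the smallness of \<sigma> keeps 8 \<epsilon> at
  most 0.32 times the minimal distance, below the separation of the empirical centers.\<close>

lemma typical_sample_recovery:
  defines "C\<^sub>1 \<equiv> 40 :: real"
  assumes k: "k \<ge> 2" and m: "m \<ge> 1" and \<sigma>: "\<sigma> > 0" and n: "n > 0"
    and c: "\<forall>a<k. \<gamma> a \<in> carrier_vec m" and inj: "inj_on \<gamma> {..<k}"
    and typical: "typical_sample m k \<gamma> \<sigma> (\<Delta>_min k \<gamma> / (4 * real m)) n \<omega>"
    and S: "S = spectral_norm (\<Gamma>_mat m k n \<omega>) / \<Delta>_min k \<gamma>"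
    and small: "\<sigma> \<le> 1/1000 * \<Delta>_min k \<gamma> / (S * real k)"
    and X: "sdp_minimizer k (k * n) (sq_dist_mat (data_mat m k n \<omega>)) X"
    and round: "rounding_output (col (data_mat m k n \<omega> * X)) (C\<^sub>1 * S * real k * \<sigma>) k {..<k * n} vs"
  shows "length vs = k \<and> (\<exists>\<pi>. \<pi> permutes {..<k} \<and>
    (\<forall>i<k. vnorm (col (data_mat m k n \<omega> * X) (vs ! i) - emp_center m n \<omega> (\<pi> i)) \<le> 3 * (C\<^sub>1 * S * real k * \<sigma>)))"
proof -
  define \<Delta> where "\<Delta> = \<Delta>_min k \<gamma>"
  define g where "g = emp_center m n \<omega>"
  define cc where "cc = col (data_mat m k n \<omega> * X)"
  define \<epsilon> where "\<epsilon> = C\<^sub>1 * S * real k * \<sigma>"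
  have \<Delta>: "\<Delta> > 0" unfolding \<Delta>_def by (rule \<Delta>_min_pos[OF k c inj])
  have g: "g a \<in> carrier_vec m" for a by (simp add: g_def emp_center_def)
  have cc: "cc p \<in> carrier_vec m" for p unfolding cc_def by (rule carrier_vecI) (simp add: data_mat_def)
  have near: "vnorm (g a - \<gamma> a) \<le> \<Delta> / 4" if "a < k" for a
    using vnorm_emp_center_le[OF typical that n] c that m by (simp add: g_def \<Delta>_def)
  \<comment> \<open>Each center moves by at most a quarter of the minimal distance, so half of it
    survives for every pair.\<close>
  have sep: "vnorm (g a - g b) \<ge> \<Delta> / 2" if ab: "a < k" "b < k" "a \<noteq> b" for a b
  proof -
    have \<gamma>: "\<gamma> a \<in> carrier_vec m" "\<gamma> b \<in> carrier_vec m" using c ab by auto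
    have "\<Delta> \<le> vnorm (\<gamma> a - \<gamma> b)" unfolding \<Delta>_def by (rule \<Delta>_min_le[OF ab])
    also have "\<dots> \<le> vnorm (\<gamma> a - g a) + vnorm (g a - \<gamma> b)"
      by (rule vnorm_triangle_diff[OF \<gamma>(1) g \<gamma>(2)])
    also have "\<dots> \<le> vnorm (g a - \<gamma> a) + (vnorm (g a - g b) + vnorm (g b - \<gamma> b))"
      using vnorm_triangle_diff[OF g[of a] g[of b] \<gamma>(2)] vnorm_diff_commute[OF g[of a] \<gamma>(1)] by simp
    finally show ?thesis using near[OF ab(1)] near[OF ab(2)] by linarith
  qed
  have S4: "S \<ge> 1/4"
  proof -
    have "\<Delta> / 4 \<le> spectral_norm (\<Gamma>_mat m k n \<omega>)"
      using vnorm_emp_center_diff_le_spectral_norm[of 0 k 1 m n \<omega>] sep[of 0 1] k by (simp add: g_def)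
    then show ?thesis using \<Delta> by (simp add: S \<Delta>_def[symmetric] field_simps)
  qed
  have \<epsilon>_ge: "10 * real k * \<sigma> \<le> \<epsilon>"
    using mult_right_mono[OF S4, of "40 * real k * \<sigma>"] \<sigma> by (simp add: \<epsilon>_def C\<^sub>1_def mult_ac)
  have \<epsilon>_pos: "\<epsilon> > 0" using \<epsilon>_ge k \<sigma> by (smt (verit) mult_pos_pos of_nat_0_less_iff less_le_trans zero_less_numeral)
  have \<epsilon>_le: "8 * \<epsilon> < \<Delta> / 2"
  proof -
    \<comment> \<open>The lower bound on \<open>S\<close> makes the denominator in
      \<open>small\<close> positive, so it can be cleared.\<close>
    have "\<sigma> * (S * real k) \<le> 1/1000 * \<Delta>"
      using small S4 k by (simp add: \<Delta>_def pos_le_divide_eq)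
    then show ?thesis using \<Delta> by (simp add: \<epsilon>_def C\<^sub>1_def mult_ac)
  qed
  define Bad where "Bad = {p \<in> {..<k * n}. vnorm (cc p - g (p div n)) > \<epsilon>}"
  define G where "G a = {p \<in> {..<k * n}. p div n = a \<and> vnorm (cc p - g a) \<le> \<epsilon>}" for a
  have finBad: "finite Bad" by (simp add: Bad_def)
  \<comment> \<open>A Markov-type count: each bad column contributes more than \<epsilon>^2 >= 100
    k^2 \<sigma>^2 to a sum of at most 28 \<sigma>^2 n k^2.\<close>
  have cardBad: "2 * card Bad < n"
  proof -
    have "real (card Bad) * \<epsilon>\<^sup>2 \<le> (\<Sum>p\<in>Bad. (vnorm (cc p - g (p div n)))\<^sup>2)"
      using \<epsilon>_pos by (intro sum_bounded_below power_mono) (auto simp: Bad_def)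
    also have "\<dots> \<le> (\<Sum>p<k * n. (vnorm (cc p - g (p div n)))\<^sup>2)"
      by (intro sum_mono2) (auto simp: Bad_def)
    also have "\<dots> \<le> 28 * \<sigma>\<^sup>2 * real n * (real k)\<^sup>2"
      unfolding cc_def g_def by (rule sdp_denoising_bound[OF typical m n X])
    finally have "real (card Bad) * \<epsilon>\<^sup>2 \<le> 28 * \<sigma>\<^sup>2 * real n * (real k)\<^sup>2" .
    moreover have "real (card Bad) * (10 * real k * \<sigma>)\<^sup>2 \<le> real (card Bad) * \<epsilon>\<^sup>2"
      using \<epsilon>_ge \<sigma> by (intro mult_left_mono power_mono) auto
    ultimately have "(100 * real (card Bad)) * (real k * \<sigma>)\<^sup>2 \<le> (28 * real n) * (real k * \<sigma>)\<^sup>2"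
      by (simp add: power_mult_distrib mult_ac)
    then have "100 * real (card Bad) \<le> 28 * real n"
      using k \<sigma> by (subst (asm) mult_le_cancel_right) auto
    then show ?thesis using n by linarith
  qed
  \<comment> \<open>Each of the n columns of cluster \<open>a\<close> is bad or lies in
    \<open>G a\<close>, and fewer than n/2 are bad.\<close>
  have cardG: "card Bad < card (G a)" if "a < k" for a
  proof -
    have "(\<lambda>t. a * n + t) ` {..<n} \<subseteq> Bad \<union> G a"
    proof clarify
      fix t assume t: "t < n" "a * n + t \<notin> G a"
      have "a * n + t < Suc a * n" using t by simp
      also have "\<dots> \<le> k * n" using that by (intro mult_right_mono) auto
      finally show "a * n + t \<in> Bad" using t by (auto simp: Bad_def G_def)
    qed
    then have "card ((\<lambda>t. a * n + t) ` {..<n}) \<le> card (Bad \<union> G a)"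
      using finBad by (intro card_mono) (auto simp: G_def)
    also have "\<dots> \<le> card Bad + card (G a)" by (rule card_Un_le)
    finally show ?thesis using cardBad by (simp add: card_image inj_on_def)
  qed
  have "length vs = k \<and> (\<exists>f. bij_betw f {..<k} {..<k} \<and> (\<forall>i<k. vnorm (cc (vs ! i) - g (f i)) \<le> 3 * \<epsilon>))"
  proof (rule rounding_output_near_centers[where G = G and V = "{..<k * n}" and Bad = Bad and m = m])
    show "rounding_output cc \<epsilon> k {..<k * n} vs" using round by (simp add: cc_def \<epsilon>_def)
    show "{..<k * n} \<subseteq> Bad \<union> (\<Union>a\<in>{..<k}. G a)"
      by (auto simp: Bad_def G_def less_mult_imp_div_less)
    show "8 * \<epsilon> < vnorm (g a - g b)" if "a \<in> {..<k}" "b \<in> {..<k}" "a \<noteq> b" for a b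
      using sep[of a b] that \<epsilon>_le by simp
  qed (use finBad \<epsilon>_pos cc g cardG in \<open>auto simp: G_def\<close>)
  then obtain f where f: "length vs = k" "bij_betw f {..<k} {..<k}"
    "\<forall>i<k. vnorm (cc (vs ! i) - g (f i)) \<le> 3 * \<epsilon>" by blast
  \<comment> \<open>\<open>permutes\<close> requires the identity outside the index set.\<close>
  define \<pi> where "\<pi> i = (if i < k then f i else i)" for i
  have "bij_betw \<pi> {..<k} {..<k}"
    using f(2) by (rule bij_betw_cong[THEN iffD1, rotated]) (simp add: \<pi>_def)
  then have "\<pi> permutes {..<k}" by (rule bij_imp_permutes) (simp add: \<pi>_def)
  moreover have "\<forall>i<k. vnorm (cc (vs ! i) - g (\<pi> i)) \<le> 3 * \<epsilon>" using f(3) by (simp add: \<pi>_def)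
  ultimately show ?thesis using f(1) unfolding cc_def g_def \<epsilon>_def by blast
qed

theorem corollary16:
  fixes c\<^sub>0 :: real
  assumes "c\<^sub>0 > 0"
  shows "\<exists>C\<^sub>1>0. \<exists>c\<^sub>2>0. \<exists>C\<^sub>3>0. \<forall>(k::nat) (m::nat) (\<sigma>::real) (\<gamma> :: nat \<Rightarrow> real vec).
    k \<ge> 2 \<and> m \<ge> 1 \<and> \<sigma> > 0 \<and> (\<forall>a<k. \<gamma> a \<in> carrier_vec m) \<and> inj_on \<gamma> {..<k}
      \<and> real k \<le> c\<^sub>0 * real m \<longrightarrow>
    with_high_probability (mixture_sample m k \<gamma> \<sigma>) (\<lambda>n \<omega>.
      let N = k * n;
          P = data_mat m k n \<omega>;
          D = sq_dist_mat P;
          S = spectral_norm (\<Gamma>_mat m k n \<omega>) / \<Delta>_min k \<gamma>;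
          \<epsilon> = C\<^sub>1 * S * real k * \<sigma>
      in \<sigma> \<le> c\<^sub>2 * \<Delta>_min k \<gamma> / (S * real k) \<longrightarrow>
         (\<forall>X vs. sdp_minimizer k N D X \<longrightarrow>
            rounding_output (col (P * X)) \<epsilon> k {..<N} vs \<longrightarrow>
            length vs = k \<and>
            (\<exists>\<pi>. \<pi> permutes {..<k} \<and>
               (\<forall>i<k. vnorm (col (P * X) (vs ! i) - emp_center m n \<omega> (\<pi> i))
                        \<le> C\<^sub>3 * S * real k * \<sigma>))))"
\<comment> \<open>The last constant is 120 = 3 * 40, since selected vertices are within 3 \<epsilon>
  of their centers.\<close>
proof (rule exI[of _ 40], rule conjI, simp, rule exI[of _ "1/1000"], rule conjI, simp,
    rule exI[of _ 120], rule conjI, simp, intro allI impI, elim conjE)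
  fix k m :: nat and \<sigma> :: real and \<gamma> :: "nat \<Rightarrow> real vec"
  assume k: "k \<ge> 2" and m: "m \<ge> 1" and \<sigma>: "\<sigma> > 0"
    and c: "\<forall>a<k. \<gamma> a \<in> carrier_vec m" and inj: "inj_on \<gamma> {..<k}"
  \<comment> \<open>Each coordinate of a center may deviate by this much, so that over m coordinates
    the center moves by at most a quarter of the minimal distance.\<close>
  have "\<Delta>_min k \<gamma> / (4 * real m) > 0"
    using \<Delta>_min_pos[OF k c inj] m by simp
  from with_high_probability_typical_sample[OF \<sigma> this m]
  show "with_high_probability (mixture_sample m k \<gamma> \<sigma>) (\<lambda>n \<omega>.
      let N = k * n;
          P = data_mat m k n \<omega>;
          D = sq_dist_mat P;
          S = spectral_norm (\<Gamma>_mat m k n \<omega>) / \<Delta>_min k \<gamma>;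
          \<epsilon> = 40 * S * real k * \<sigma>
      in \<sigma> \<le> 1/1000 * \<Delta>_min k \<gamma> / (S * real k) \<longrightarrow>
         (\<forall>X vs. sdp_minimizer k N D X \<longrightarrow>
            rounding_output (col (P * X)) \<epsilon> k {..<N} vs \<longrightarrow>
            length vs = k \<and>
            (\<exists>\<pi>. \<pi> permutes {..<k} \<and>
               (\<forall>i<k. vnorm (col (P * X) (vs ! i) - emp_center m n \<omega> (\<pi> i))
                        \<le> 120 * S * real k * \<sigma>))))"
  proof (rule with_high_probability_mono, unfold Let_def, intro impI allI)
    fix n \<omega> X vs
    define S where "S = spectral_norm (\<Gamma>_mat m k n \<omega>) / \<Delta>_min k \<gamma>"
    assume "n > 0" "typical_sample m k \<gamma> \<sigma> (\<Delta>_min k \<gamma> / (4 * real m)) n \<omega>"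
      "\<sigma> \<le> 1/1000 * \<Delta>_min k \<gamma> / (spectral_norm (\<Gamma>_mat m k n \<omega>) / \<Delta>_min k \<gamma> * real k)"
      "sdp_minimizer k (k * n) (sq_dist_mat (data_mat m k n \<omega>)) X"
      "rounding_output (col (data_mat m k n \<omega> * X))
        (40 * (spectral_norm (\<Gamma>_mat m k n \<omega>) / \<Delta>_min k \<gamma>) * real k * \<sigma>) k {..<k * n} vs"
    from typical_sample_recovery[OF k m \<sigma> this(1) c inj this(2) S_def this(3-5)[folded S_def]]
    show "length vs = k \<and> (\<exists>\<pi>. \<pi> permutes {..<k} \<and>
        (\<forall>i<k. vnorm (col (data_mat m k n \<omega> * X) (vs ! i) - emp_center m n \<omega> (\<pi> i))
          \<le> 120 * (spectral_norm (\<Gamma>_mat m k n \<omega>) / \<Delta>_min k \<gamma>) * real k * \<sigma>))"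
      unfolding S_def[symmetric] by (simp add: mult_ac)
  qed
qed

end
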